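(* Let $\mathsf{M}$ be a sparse paving matroid having $n$ elements, rank $k$, and exactly $\lambda$ circuit-hyperplanes. Then \[ \operatorname{ehr}(\mathsf{M},t)=\operatorname{ehr}(\mathsf{U}_{k,n},t)-\lambda\,\operatorname{ehr}(\mathsf{T}_{k,n},t-1) \] as polynomials in $t$.
   Context: For a matroid $\mathsf{M}$ on $E=\{1,\ldots,n\}$ with set of bases $\mathscr{B}$, the base polytope is $\mathscr{P}(\mathsf{M})=\operatorname{conv}\{e_B : B\in\mathscr{B}\}\subseteq\mathbb{R}^n$, where $e_B=\sum_{i\in B}e_i$. The Ehrhart polynomial $\operatorname{ehr}(\mathsf{M},t)$ is the polynomial with $\operatorname{ehr}(\mathsf{M},t)=\#(t\mathscr{P}(\mathsf{M})\cap\mathbb{Z}^n)$ for all nonnegative integers $t$. $\mathsf{U}_{k,n}$ is the uniform matroid of rank $k$ on $n$ elements. The minimal matroid $\mathsf{T}_{k,n}$ is the graphic matroid (with $n$ elements and rank $k$) of the graph obtained from a cycle of length $k+1$ by replacing one of its edges by $n-k$ parallel copies. A matroid of rank $k$ is paving if every circuit has cardinality at least $k$; it is sparse paving if both it and its dual are paving. A hyperplane is a flat of rank $k-1$; a circuit-hyperplane is a subset that is both a circuit and a hyperplane. *)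

theory Defs
  imports
    "HOL-Analysis.Analysis"
    "HOL-Analysis.Finite_Function_Topology"
    "HOL-Computational_Algebra.Polynomial"
begin

subsection \<open>Matroids, given by their bases\<close>

record 'a basis_system =
  ground :: "'a set"
  bases :: "'a set set"

locale matroid =
  fixes M :: "'a basis_system"
  assumes finite_ground: "finite (ground M)"
    and bases_subset: "B \<in> bases M \<Longrightarrow> B \<subseteq> ground M"
    and bases_nonempty: "bases M \<noteq> {}"
    and basis_exchange:
      "\<lbrakk>A \<in> bases M; B \<in> bases M; x \<in> A - B\<rbrakk> \<Longrightarrow> \<exists>y \<in> B - A. insert y (A - {x}) \<in> bases M"

definition indep :: "'a basis_system \<Rightarrow> 'a set \<Rightarrow> bool" where
  "indep M I \<longleftrightarrow> (\<exists>B \<in> bases M. I \<subseteq> B)"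

definition circuit :: "'a basis_system \<Rightarrow> 'a set \<Rightarrow> bool" where
  "circuit M C \<longleftrightarrow> C \<subseteq> ground M \<and> \<not> indep M C \<and> (\<forall>D. D \<subset> C \<longrightarrow> indep M D)"

definition rank_in :: "'a basis_system \<Rightarrow> 'a set \<Rightarrow> nat" where
  "rank_in M X = Max (card ` {I. I \<subseteq> X \<and> indep M I})"

definition matroid_rank :: "'a basis_system \<Rightarrow> nat" where
  "matroid_rank M = rank_in M (ground M)"

definition flat :: "'a basis_system \<Rightarrow> 'a set \<Rightarrow> bool" where
  "flat M F \<longleftrightarrow> F \<subseteq> ground M \<and> (\<forall>x \<in> ground M - F. rank_in M F < rank_in M (insert x F))"

text \<open>The rank condition is written additively, so that a matroid of rank \<open>0\<close> has no hyperplanes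
  (natural-number subtraction would turn its rank-\<open>0\<close> flat into one).\<close>

definition hyperplane :: "'a basis_system \<Rightarrow> 'a set \<Rightarrow> bool" where
  "hyperplane M H \<longleftrightarrow> flat M H \<and> rank_in M H + 1 = matroid_rank M"

definition circuit_hyperplane :: "'a basis_system \<Rightarrow> 'a set \<Rightarrow> bool" where
  "circuit_hyperplane M X \<longleftrightarrow> circuit M X \<and> hyperplane M X"

definition dual :: "'a basis_system \<Rightarrow> 'a basis_system" where
  "dual M = \<lparr>ground = ground M, bases = (\<lambda>B. ground M - B) ` bases M\<rparr>"

definition paving :: "'a basis_system \<Rightarrow> bool" where
  "paving M \<longleftrightarrow> (\<forall>C. circuit M C \<longrightarrow> matroid_rank M \<le> card C)"

definition sparse_paving :: "'a basis_system \<Rightarrow> bool" where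
  "sparse_paving M \<longleftrightarrow> paving M \<and> paving (dual M)"

definition uniform_matroid :: "nat \<Rightarrow> nat \<Rightarrow> nat basis_system" where
  "uniform_matroid k n = \<lparr>ground = {1..n}, bases = {B. B \<subseteq> {1..n} \<and> card B = k}\<rparr>"


subsection \<open>Graphic matroids\<close>

text \<open>Undirected multigraphs: \<open>ends e\<close> is the set of endpoints of the edge \<open>e\<close>, a singleton exactly
  when \<open>e\<close> is a loop.\<close>

record ('v, 'e) multigraph =
  verts :: "'v set"
  edges :: "'e set"
  ends :: "'e \<Rightarrow> 'v set"

text \<open>Edge sets of cycles, where a loop is a cycle of length \<open>1\<close> and a pair of parallel edges is a
  cycle of length \<open>2\<close>.\<close>

definition is_cycle :: "('v, 'e) multigraph \<Rightarrow> 'e set \<Rightarrow> bool" where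
  "is_cycle G C \<longleftrightarrow>
     (\<exists>vs es. es \<noteq> [] \<and> length vs = length es \<and> distinct vs \<and> distinct es \<and>
        set vs \<subseteq> verts G \<and> set es \<subseteq> edges G \<and> C = set es \<and>
        (\<forall>i < length es. ends G (es ! i) = {vs ! i, vs ! (Suc i mod length es)}))"

definition forest :: "('v, 'e) multigraph \<Rightarrow> 'e set \<Rightarrow> bool" where
  "forest G F \<longleftrightarrow> F \<subseteq> edges G \<and> (\<forall>C. is_cycle G C \<longrightarrow> \<not> C \<subseteq> F)"

definition graphic_matroid :: "('v, 'e) multigraph \<Rightarrow> 'e basis_system" where
  "graphic_matroid G =
     \<lparr>ground = edges G, bases = {F. forest G F \<and> (\<forall>F'. forest G F' \<and> F \<subseteq> F' \<longrightarrow> F' = F)}\<rparr>"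

text \<open>The cycle of length \<open>k + 1\<close> on the vertices \<open>0, \<dots>, k\<close> has the edges \<open>{0, 1}, \<dots>, {k - 1, k}\<close>,
  labelled \<open>1, \<dots>, k\<close>, and a closing edge \<open>{k, 0}\<close>. The latter is replaced by \<open>n - k\<close> parallel copies,
  labelled \<open>k + 1, \<dots>, n\<close> (none if \<open>n = k\<close>, and loops if \<open>k = 0\<close>).\<close>

definition minimal_graph :: "nat \<Rightarrow> nat \<Rightarrow> (nat, nat) multigraph" where
  "minimal_graph k n =
     \<lparr>verts = {0..k}, edges = {1..n}, ends = (\<lambda>i. if i \<le> k then {i - 1, i} else {k, 0})\<rparr>"

definition minimal_matroid :: "nat \<Rightarrow> nat \<Rightarrow> nat basis_system" where
  "minimal_matroid k n = graphic_matroid (minimal_graph k n)"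


subsection \<open>Base polytopes and Ehrhart polynomials\<close>

text \<open>For a finite set \<open>E\<close>, the space \<open>\<real>\<^sup>E\<close> is represented by the finitely supported functions
  \<open>'a \<Rightarrow>\<^sub>0 real\<close> with support in \<open>E\<close>; the \<open>i\<close>-th unit vector is \<open>Poly_Mapping.single i 1\<close>.\<close>

definition indicator_vector :: "'a set \<Rightarrow> 'a \<Rightarrow>\<^sub>0 real" where
  "indicator_vector B = (\<Sum>i\<in>B. Poly_Mapping.single i 1)"

definition base_polytope :: "'a basis_system \<Rightarrow> ('a \<Rightarrow>\<^sub>0 real) set" where
  "base_polytope M = convex hull (indicator_vector ` bases M)"

definition integer_points :: "'a set \<Rightarrow> ('a \<Rightarrow>\<^sub>0 real) set" where
  "integer_points E = {x. Poly_Mapping.keys x \<subseteq> E \<and> (\<forall>i. Poly_Mapping.lookup x i \<in> \<int>)}"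

definition lattice_count :: "'a basis_system \<Rightarrow> nat \<Rightarrow> nat" where
  "lattice_count M t =
     card ((\<lambda>x. real t *\<^sub>R x) ` base_polytope M \<inter> integer_points (ground M))"

definition ehr :: "'a basis_system \<Rightarrow> real poly" where
  "ehr M = (THE p. \<forall>t::nat. poly p (real t) = real (lattice_count M t))"

lemma ehr_eqI:
  assumes p: "\<And>t::nat. poly p (real t) = real (lattice_count M t)"
  shows "ehr M = p"
  unfolding ehr_def
proof (rule the_equality)
  show "\<forall>t::nat. poly p (real t) = real (lattice_count M t)"
    using p by simp
next
  fix q assume q: "\<forall>t::nat. poly q (real t) = real (lattice_count M t)"
  have "range real \<subseteq> {x. poly (q - p) x = 0}"
    using p q by auto
  moreover have "infinite (range real)"
    by (simp add: range_inj_infinite)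
  ultimately show "q = p"
    by (metis finite_subset poly_roots_finite eq_iff_diff_eq_0)
qed

end

theory Submission
  imports Defs
begin

text \<open>The circuit-hyperplanes of a sparse paving matroid of rank \<open>k\<close> are exactly its nonbases of size
  \<open>k\<close>, and no two of them differ by a single exchange. Hence an integer point \<open>f\<close> of the \<open>t\<close>-fold dilate
  of the hypersimplex \<open>P(U\<^bsub>k,n\<^esub>)\<close> lies in the dilate of \<open>P(M)\<close> iff \<open>f(X) \<le> (k - 1) t\<close> for every
  circuit-hyperplane \<open>X\<close>, and it violates at most one of these inequalities. The number of points
  violating the one for \<open>X\<close> is \<open>\<Sum>\<^bsub>s < t\<^esub> C(s + k - 1, k - 1) C(s + n - k - 1, n - k - 1)\<close>, with \<open>s = k t - f(X)\<close>.
  The minimal matroid has the bases at most one exchange away from a fixed basis \<open>X\<close>, so its dilate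
  is \<open>f(X) \<ge> (k - 1) t\<close>, which gives the same sum with \<open>s \<le> t\<close>: this is the shift from \<open>t\<close> to \<open>t - 1\<close>.
  At \<open>t = 0\<close> the shift evaluates the Ehrhart polynomial at \<open>-1\<close>, where it vanishes.\<close>

subsection \<open>Sparse paving matroids\<close>

text \<open>Induction on the size of \<open>A - B\<close>: an exchange keeps the size of
  \<open>A\<close> and moves it closer to \<open>B\<close>. Once \<open>A\<close> lies inside
  \<open>B\<close>, the exchange axiom leaves no element of \<open>B\<close> outside
  \<open>A\<close>.\<close>

lemma (in matroid) bases_same_card:
  assumes "A \<in> bases M" "B \<in> bases M"
  shows "card A = card B"
  using assms
proof (induction "card (A - B)" arbitrary: A rule: less_induct)
  case less
  have fin: "finite A" "finite B"
    using less.prems bases_subset finite_ground finite_subset by blast+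
  show ?case
  proof (cases "A \<subseteq> B")
    case True
    moreover have "B \<subseteq> A"
      using basis_exchange[OF less.prems(2,1)] True by blast
    ultimately show ?thesis by simp
  next
    case False
    then obtain x where x: "x \<in> A - B" by blast
    then obtain y where y: "y \<in> B - A" "insert y (A - {x}) \<in> bases M"
      using basis_exchange less.prems by blast
    have "insert y (A - {x}) - B = (A - B) - {x}" using x y by auto
    then have "card (insert y (A - {x}) - B) < card (A - B)"
      using card_Diff1_less[OF finite_Diff[OF fin(1)] x] by simp
    then have "card (insert y (A - {x})) = card B"
      using less.hyps y(2) less.prems(2) by blast
    then show ?thesis using x y(1) fin card_Suc_Diff1[of A x] by (simp add: card_insert_if)
  qed
qed

lemma rank_in_eqI:
  assumes "finite X" "I \<subseteq> X" "indep M I" "card I = r"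
    and "\<And>J. J \<subseteq> X \<Longrightarrow> indep M J \<Longrightarrow> card J \<le> r"
  shows "rank_in M X = r"
  unfolding rank_in_def
proof (rule Max_eqI)
  show "finite (card ` {I. I \<subseteq> X \<and> indep M I})" using assms(1) by simp
qed (use assms in auto)

lemma matroid_rank_eqI:
  assumes "finite (ground M)" "B \<in> bases M"
    and "\<And>B. B \<in> bases M \<Longrightarrow> B \<subseteq> ground M \<and> card B = r"
  shows "matroid_rank M = r"
  unfolding matroid_rank_def
proof (rule rank_in_eqI[of _ B])
  show "card J \<le> r" if "J \<subseteq> ground M" "indep M J" for J
    using that assms(1,3) unfolding indep_def by (metis card_mono finite_subset)
qed (use assms in \<open>auto simp: indep_def\<close>)

text \<open>A dependent set contains a minimal dependent one. This is a circuit, and paving forbids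
  circuits smaller than the rank.\<close>

lemma paving_imp_indep:
  assumes "finite I" "paving M" "I \<subseteq> ground M" "card I < matroid_rank M"
  shows "indep M I"
proof (rule ccontr)
  assume "\<not> indep M I"
  then obtain C where C: "C \<subseteq> I" "\<not> indep M C" "\<And>D. D \<subseteq> I \<Longrightarrow> \<not> indep M D \<Longrightarrow> D \<subseteq> C \<Longrightarrow> C = D"
    using finite_has_minimal[of "{C. C \<subseteq> I \<and> \<not> indep M C}"] assms(1) by fastforce
  then have "circuit M C" unfolding circuit_def using assms(3) by blast
  then have "matroid_rank M \<le> card C" using assms(2) by (simp add: paving_def)
  then show False using card_mono[OF assms(1) C(1)] assms(4) by simp
qed

locale sparse_paving_matroid = matroid +
  assumes sparse: "sparse_paving M"
begin

abbreviation "nonbases \<equiv> {X. X \<subseteq> ground M \<and> card X = matroid_rank M \<and> X \<notin> bases M}"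

lemma finite_subset_ground: "X \<subseteq> ground M \<Longrightarrow> finite X"
  using finite_ground finite_subset by blast

lemma card_basis:
  assumes "B \<in> bases M"
  shows "card B = matroid_rank M"
proof -
  have "matroid_rank M = card B"
    using assms by (intro matroid_rank_eqI[OF finite_ground assms]) (auto dest: bases_subset bases_same_card)
  then show ?thesis ..
qed

lemma card_indep_le: "indep M I \<Longrightarrow> card I \<le> matroid_rank M"
  unfolding indep_def using card_mono[OF finite_subset_ground[OF bases_subset]] card_basis by fastforce

lemma rank_le_card_ground: "matroid_rank M \<le> card (ground M)"
proof -
  obtain B where "B \<in> bases M" using bases_nonempty by blast
  then show ?thesis using card_mono[OF finite_ground bases_subset] card_basis by metis
qed

lemma indep_if_small: "I \<subseteq> ground M \<Longrightarrow> card I < matroid_rank M \<Longrightarrow> indep M I"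
  using sparse finite_subset_ground by (intro paving_imp_indep) (auto simp: sparse_paving_def)

text \<open>Here paving of the dual enters: the complement of \<open>Z\<close> is smaller than the
  rank of the dual, hence independent there. So it misses some basis of \<open>M\<close>, which then
  lies in \<open>Z\<close>.\<close>

lemma spanning_if_large:
  assumes "Z \<subseteq> ground M" "matroid_rank M < card Z"
  shows "\<exists>B\<in>bases M. B \<subseteq> Z"
proof -
  obtain B where B: "B \<in> bases M" using bases_nonempty by blast
  have rank: "matroid_rank (dual M) = card (ground M) - matroid_rank M"
  proof (rule matroid_rank_eqI)
    show "ground M - B \<in> bases (dual M)" using B by (simp add: dual_def)
    show "finite (ground (dual M))" using finite_ground by (simp add: dual_def)
    show "A \<subseteq> ground (dual M) \<and> card A = card (ground M) - matroid_rank M" if "A \<in> bases (dual M)" for A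
      using that bases_subset card_basis finite_subset_ground[OF bases_subset]
      by (auto simp: dual_def card_Diff_subset)
  qed
  have "card (ground M - Z) = card (ground M) - card Z" "card Z \<le> card (ground M)"
    using finite_subset_ground[OF assms(1)] assms(1) finite_ground by (auto simp: card_Diff_subset card_mono)
  then have "indep (dual M) (ground M - Z)"
    using sparse assms rank finite_ground
    by (intro paving_imp_indep) (auto simp: sparse_paving_def dual_def)
  then obtain B' where B': "B' \<in> bases M" "ground M - Z \<subseteq> ground M - B'"
    by (auto simp: indep_def dual_def)
  then have "B' \<subseteq> Z" using bases_subset[OF B'(1)] by blast
  then show ?thesis using B'(1) by blast
qed

text \<open>If \<open>X\<close> and its neighbour were both nonbases, \<open>X - {a}\<close> would
  extend to a basis by some \<open>c\<close> other than \<open>a\<close> and \<open>b\<close>. The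
  set \<open>insert b X\<close> contains a basis, which avoids \<open>c\<close>; exchanging
  \<open>c\<close> for an element of it can only produce \<open>X\<close> or the neighbour.\<close>

lemma nonbases_neighbour:
  assumes X: "X \<in> nonbases" and a: "a \<in> X" and b: "b \<in> ground M - X"
  shows "insert b (X - {a}) \<in> bases M"
proof (rule ccontr)
  assume notbasis: "insert b (X - {a}) \<notin> bases M"
  let ?I = "X - {a}"
  have finX: "finite X" using X finite_subset_ground by blast
  have "card ?I < matroid_rank M" using X a finX card_Diff1_less[of X a] by auto
  then obtain A where A: "A \<in> bases M" "?I \<subseteq> A"
    using X indep_if_small[of ?I] unfolding indep_def by blast
  have "card A = Suc (card ?I)"
    using A(1) X card_Suc_Diff1[OF finX a] by (simp add: card_basis)
  then have "card (A - ?I) = 1" using A finX by (simp add: card_Diff_subset)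
  then obtain c where "A - ?I = {c}" using card_1_singletonE by blast
  then have c: "A = insert c ?I" "c \<notin> ?I" using A by auto
  have cX: "c \<noteq> a" "c \<noteq> b" using c A X a notbasis by (auto simp: insert_absorb)
  have "card (insert b X) = Suc (matroid_rank M)" using X b finX by simp
  then obtain B where B: "B \<in> bases M" "B \<subseteq> insert b X"
    using spanning_if_large[of "insert b X"] X b by auto
  then have "c \<in> A - B" using c cX by auto
  then obtain y where y: "y \<in> B - A" "insert y (A - {c}) \<in> bases M"
    using basis_exchange A B by blast
  have "A - {c} = ?I" using c by auto
  moreover have "y = a \<or> y = b" using y B c by auto
  ultimately show False using y X a notbasis by (auto simp: insert_absorb)
qed

text \<open>In rank 0 and in full rank only one subset has the right size, and it is a basis. So a
  nonbasis forces both the rank and the corank to be positive, as the counts with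
  \<open>Suc a\<close> and \<open>Suc b\<close> require.\<close>

lemma nonbasis_between:
  assumes "X \<in> nonbases"
  shows "0 < matroid_rank M" "matroid_rank M < card (ground M)"
proof -
  obtain B where B: "B \<in> bases M" using bases_nonempty by blast
  have finX: "finite X" using assms finite_subset_ground by blast
  show "0 < matroid_rank M"
  proof (rule ccontr)
    assume "\<not> ?thesis"
    then have "X = {}" using assms finX by simp
    moreover have "finite B" using B bases_subset finite_subset_ground by blast
    then have "B = {}" using \<open>\<not> _\<close> card_basis[OF B] by simp
    ultimately show False using assms B by auto
  qed
  show "matroid_rank M < card (ground M)"
  proof (rule ccontr)
    assume "\<not> ?thesis"
    then have "X = ground M" "B = ground M"
      using assms B card_basis[OF B] bases_subset[OF B] finite_ground card_seteq[of "ground M"]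
      by simp_all
    then show False using assms B by auto
  qed
qed

text \<open>A circuit has rank one less than its size and a hyperplane one less than the rank of
  \<open>M\<close>, so the two numbers agree. Conversely, smaller sets are independent, which makes
  a nonbasis a circuit, and larger sets are spanning, which makes it a hyperplane.\<close>

lemma circuit_hyperplane_iff: "circuit_hyperplane M X \<longleftrightarrow> X \<in> nonbases"
proof
  assume X: "circuit_hyperplane M X"
  then have sub: "X \<subseteq> ground M" and dep: "\<not> indep M X" and min: "\<And>D. D \<subset> X \<Longrightarrow> indep M D"
    and rank: "rank_in M X + 1 = matroid_rank M"
    by (auto simp: circuit_hyperplane_def circuit_def hyperplane_def flat_def)
  have finX: "finite X" using sub finite_subset_ground by blast
  have "X \<noteq> {}" using dep bases_nonempty unfolding indep_def by blast
  then obtain a where a: "a \<in> X" by blast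
  have "rank_in M X = card (X - {a})"
  proof (rule rank_in_eqI[OF finX, of "X - {a}"])
    show "card J \<le> card (X - {a})" if "J \<subseteq> X" "indep M J" for J
    proof -
      have "J \<subset> X" using that dep by blast
      then show ?thesis using psubset_card_mono[OF finX, of J] card_Suc_Diff1[OF finX a] by simp
    qed
  qed (use a min in auto)
  then have "card X = matroid_rank M" using rank a finX card_Suc_Diff1[of X a] by simp
  moreover have "X \<notin> bases M" using dep unfolding indep_def by blast
  ultimately show "X \<in> nonbases" using sub by blast
next
  assume X: "X \<in> nonbases"
  have finX: "finite X" using X finite_subset_ground by blast
  have dep: "\<not> indep M X"
  proof
    assume "indep M X"
    then obtain B where B: "B \<in> bases M" "X \<subseteq> B" unfolding indep_def by blast
    then have "X = B"
      using X card_basis bases_subset finite_subset_ground by (intro card_subset_eq) auto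
    then show False using B X by blast
  qed
  have min: "indep M D" if "D \<subset> X" for D
    using that X finX psubset_card_mono[of X D] by (intro indep_if_small) auto
  have "card X \<noteq> 0" using nonbasis_between[OF X] X by simp
  then obtain a where a: "a \<in> X" using finX by fastforce
  have cardXa: "card (X - {a}) + 1 = matroid_rank M" using X card_Suc_Diff1[OF finX a] by simp
  have rank: "rank_in M X = card (X - {a})"
  proof (rule rank_in_eqI[OF finX, of "X - {a}"])
    show "card J \<le> card (X - {a})" if "J \<subseteq> X" "indep M J" for J
    proof -
      have "J \<subset> X" using that dep by blast
      then show ?thesis using psubset_card_mono[OF finX, of J] card_Suc_Diff1[OF finX a] by simp
    qed
  qed (use a min in auto)
  have "rank_in M (insert b X) = matroid_rank M" if b: "b \<in> ground M - X" for b
  proof -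
    have "card (insert b X) = Suc (matroid_rank M)" using X b finX by simp
    then obtain B where "B \<in> bases M" "B \<subseteq> insert b X"
      using spanning_if_large[of "insert b X"] X b by auto
    then show ?thesis
      using finX card_basis by (intro rank_in_eqI[of _ B] card_indep_le) (auto simp: indep_def)
  qed
  then show "circuit_hyperplane M X"
    unfolding circuit_hyperplane_def circuit_def hyperplane_def flat_def
    using X dep min rank cardXa by auto
qed

end

subsection \<open>Points with prescribed sum in a box\<close>

text \<open>The polynomial \<open>(x + d) choose d\<close>, which counts weak compositions of
  \<open>x\<close> into \<open>d + 1\<close> parts. Its roots are -1, ..., -d, so just below 0 it
  continues the count by zero.\<close>

definition binom_poly :: "nat \<Rightarrow> real poly" where
  "binom_poly d = smult (1 / fact d) (\<Prod>i<d. [:real d - real i, 1:])"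

lemma poly_binom_poly: "poly (binom_poly d) x = (x + real d) gchoose d"
  by (simp add: binom_poly_def gbinomial_prod_rev poly_prod atLeast0LessThan algebra_simps)

lemma binom_poly_diff:
  "poly (binom_poly (Suc d)) x - poly (binom_poly (Suc d)) (x - 1) = poly (binom_poly d) x"
  using gbinomial_Suc_Suc[of "x + real d" d] by (simp add: poly_binom_poly algebra_simps)

lemma binom_poly_neg_one: "poly (binom_poly (Suc d)) (-1) = 0"
  by (simp add: poly_binom_poly flip: binomial_gbinomial)

lemma degree_binom_poly: "degree (binom_poly d) = d"
  by (simp add: binom_poly_def degree_prod_eq_sum_degree)

lemma lead_coeff_binom_poly: "coeff (binom_poly d) d = 1 / fact d"
proof -
  have "lead_coeff (binom_poly d) = 1 / fact d"
    by (simp add: binom_poly_def lead_coeff_smult lead_coeff_prod)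
  then show ?thesis by (simp add: degree_binom_poly)
qed

text \<open>Cancel the leading term by a multiple of \<open>binom_poly d\<close>, whose
  antidifference \<open>binom_poly (Suc d)\<close> vanishes at -1.\<close>

lemma ex_antidifference:
  fixes p :: "real poly"
  shows "\<exists>q. poly q (-1) = 0 \<and> (\<forall>x. poly q x - poly q (x - 1) = poly p x)"
\<comment> \<open>The measure puts 0 strictly below the nonzero constants, which have degree 0 as
  well.\<close>
proof (induction "if p = 0 then 0 else Suc (degree p)" arbitrary: p rule: less_induct)
  case less
  show ?case
  proof (cases "p = 0")
    case True
    then show ?thesis by (intro exI[of _ 0]) simp
  next
    case False
    define d where "d = degree p"
    define c where "c = lead_coeff p * fact d"
    define p' where "p' = p - smult c (binom_poly d)"
    have coeff: "coeff p' d = 0"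
      by (simp add: p'_def c_def d_def lead_coeff_binom_poly)
    have deg: "degree p' \<le> d"
      unfolding p'_def by (rule degree_diff_le) (auto simp: d_def degree_binom_poly)
    have "p' = 0 \<or> degree p' < d"
      using coeff deg by (metis eq_zero_or_degree_less)
    then have "\<exists>q. poly q (-1) = 0 \<and> (\<forall>x. poly q x - poly q (x - 1) = poly p' x)"
      using False by (intro less) (auto simp: d_def)
    then obtain q where q: "poly q (-1) = 0" "\<And>x. poly q x - poly q (x - 1) = poly p' x"
      by blast
    have "poly (q + smult c (binom_poly (Suc d))) x - poly (q + smult c (binom_poly (Suc d))) (x - 1)
        = poly p x" for x
    proof -
      have "poly (q + smult c (binom_poly (Suc d))) x - poly (q + smult c (binom_poly (Suc d))) (x - 1)
        = (poly q x - poly q (x - 1))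
          + c * (poly (binom_poly (Suc d)) x - poly (binom_poly (Suc d)) (x - 1))"
        by (simp add: algebra_simps)
      then show ?thesis by (simp only: q binom_poly_diff) (simp add: p'_def)
    qed
    then show ?thesis
      using q(1) by (intro exI[of _ "q + smult c (binom_poly (Suc d))"]) (simp add: binom_poly_neg_one)
  qed
qed

text \<open>The sum telescopes. At \<open>t = 0\<close> the empty sum matches the prescribed root -1
  of the antidifference.\<close>

corollary ex_sum_poly:
  fixes p :: "real poly"
  shows "\<exists>q. \<forall>t. poly q (real t - 1) = (\<Sum>s<t. poly p (real s))"
proof -
  obtain q where q: "poly q (-1) = 0" "\<And>x. poly q x - poly q (x - 1) = poly p x"
    using ex_antidifference by blast
  have "poly q (real t - 1) = (\<Sum>s<t. poly p (real s))" for t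
  proof (induction t)
    case (Suc t)
    then show ?case using q(2)[of "real t"] by simp
  qed (simp add: q)
  then show ?thesis by blast
qed

section \<open>Counting box points by inclusion-exclusion\<close>

text \<open>Vanishing off \<open>A\<close> makes each point a unique total function. The total
  \<open>m\<close> is an integer, so that coordinates can be subtracted from it without truncation;
  a negative total gives the empty set.\<close>

definition box_points :: "'a set \<Rightarrow> nat \<Rightarrow> int \<Rightarrow> ('a \<Rightarrow> nat) set" where
  "box_points A t m = {f. (\<forall>i. i \<notin> A \<longrightarrow> f i = 0) \<and> (\<forall>i. f i \<le> t) \<and> int (sum f A) = m}"

lemma box_points_iff:
  "f \<in> box_points A t (int m) \<longleftrightarrow> (\<forall>i. i \<notin> A \<longrightarrow> f i = 0) \<and> (\<forall>i. f i \<le> t) \<and> sum f A = m"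
  by (simp only: box_points_def mem_Collect_eq of_nat_eq_iff)

lemma finite_box_points:
  assumes "finite A"
  shows "finite (box_points A t m)"
proof (rule finite_subset)
  show "box_points A t m \<subseteq> {f. \<forall>i. (i \<in> A \<longrightarrow> f i \<in> {..t}) \<and> (i \<notin> A \<longrightarrow> f i = 0)}"
    by (auto simp: box_points_def)
  show "finite \<dots>"
    using assms by (intro finite_set_of_finite_funs) auto
qed

lemma box_points_empty: "box_points {} t m = (if m = 0 then {\<lambda>_. 0} else {})"
  by (auto simp: box_points_def)

text \<open>Sort the points by their value at \<open>a\<close>; resetting this value to 0 leaves a
  point over \<open>A\<close>.\<close>

lemma card_box_points_insert:
  assumes "finite A" "a \<notin> A"
  shows "card (box_points (insert a A) t m) = (\<Sum>i\<le>t. card (box_points A t (m - int i)))"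
proof -
  have "box_points (insert a A) t m = (\<Union>i\<in>{..t}. (\<lambda>f. f(a := i)) ` box_points A t (m - int i))"
    (is "_ = (\<Union>i\<in>_. ?S i)")
  proof (intro equalityI subsetI)
    fix f assume f: "f \<in> box_points (insert a A) t m"
    have "sum (f(a := 0)) A = sum f A"
      using assms by (intro sum.cong) auto
    then have "f(a := 0) \<in> box_points A t (m - int (f a))"
      using f assms by (auto simp: box_points_def simp del: of_nat_sum)
    moreover have "f = (f(a := 0))(a := f a)" by simp
    ultimately have "f \<in> ?S (f a)" by blast
    moreover have "f a \<le> t" using f by (simp add: box_points_def)
    ultimately show "f \<in> (\<Union>i\<in>{..t}. ?S i)" by blast
  next
    fix f assume "f \<in> (\<Union>i\<in>{..t}. ?S i)"
    then obtain i g where ig: "i \<le> t" "g \<in> box_points A t (m - int i)" "f = g(a := i)" by auto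
    moreover have "sum (g(a := i)) A = sum g A"
      using assms by (intro sum.cong) auto
    ultimately show "f \<in> box_points (insert a A) t m"
      using assms by (auto simp: box_points_def simp del: of_nat_sum)
  qed
  moreover have "card (\<Union>i\<in>{..t}. ?S i) = (\<Sum>i\<le>t. card (?S i))"
    using assms by (intro card_UN_disjoint) (auto simp: finite_box_points fun_upd_eqD)
  moreover have "card (?S i) = card (box_points A t (m - int i))" for i
  proof (rule card_image, rule inj_onI)
    fix f g assume fg: "f \<in> box_points A t (m - int i)" "g \<in> box_points A t (m - int i)"
      "f(a := i) = g(a := i)"
    have "f j = g j" for j
      using fg assms(2) by (cases "j = a") (auto simp: box_points_def fun_eq_iff split: if_splits)
    then show "f = g" by blast
  qed
  ultimately show ?thesis by simp
qed

text \<open>Note the shift: \<open>compositions r m\<close> counts weak compositions into \<open>r + 1\<close> parts.\<close>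

definition compositions :: "nat \<Rightarrow> int \<Rightarrow> real" where
  "compositions r m = (if m < 0 then 0 else poly (binom_poly r) (of_int m))"

lemma compositions_diff: "compositions (Suc r) m - compositions (Suc r) (m - 1) = compositions r m"
\<comment> \<open>Here the cutoff separates the two terms; it is harmless because
  \<open>binom_poly (Suc r)\<close> vanishes at -1.\<close>
proof (cases "m = 0")
  case True
  then show ?thesis
    using binom_poly_diff[of r 0] binom_poly_neg_one[of r] by (simp add: compositions_def)
next
  case False
  then show ?thesis
    using binom_poly_diff[of r "of_int m"] by (auto simp: compositions_def)
qed

lemma sum_compositions:
  "(\<Sum>i\<le>t. compositions r (m - int i)) = compositions (Suc r) m - compositions (Suc r) (m - int t - 1)"
proof (induction t)
  case 0
  then show ?case by (simp add: compositions_diff)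
next
  case (Suc t)
  then show ?case using compositions_diff[of r "m - int t - 1"] by (simp add: algebra_simps)
qed

text \<open>Pascal's rule after an index shift. It turns the difference contributed by one more
  coordinate into the next row of binomial coefficients.\<close>

lemma alternating_sum_Suc:
  fixes h :: "nat \<Rightarrow> real"
  shows "(\<Sum>j\<le>n. (-1)^j * real (n choose j) * (h j - h (Suc j)))
       = (\<Sum>j\<le>Suc n. (-1)^j * real (Suc n choose j) * h j)"
proof -
  have "(\<Sum>j\<le>Suc n. (-1)^j * real (Suc n choose j) * h j)
      = h 0 + (\<Sum>j\<le>n. - ((-1)^j * real (n choose j) * h (Suc j)))
        + (\<Sum>j\<le>n. (-1)^Suc j * real (n choose Suc j) * h (Suc j))"
    by (simp only: sum.atMost_Suc_shift add.assoc flip: sum.distrib) (simp add: algebra_simps)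
  also have "h 0 + (\<Sum>j\<le>n. - ((-1)^j * real (n choose j) * h (Suc j)))
        + (\<Sum>j\<le>n. (-1)^Suc j * real (n choose Suc j) * h (Suc j))
      = (\<Sum>j\<le>Suc n. (-1)^j * real (n choose j) * h j)
        - (\<Sum>j\<le>n. (-1)^j * real (n choose j) * h (Suc j))"
    unfolding sum.atMost_Suc_shift[of _ n] by (simp add: sum_negf)
  also have "\<dots> = (\<Sum>j\<le>n. (-1)^j * real (n choose j) * (h j - h (Suc j)))"
    by (simp add: right_diff_distrib sum_subtractf)
  finally show ?thesis ..
qed

text \<open>Inclusion--exclusion over the coordinates exceeding \<open>t\<close>.\<close>

lemma card_box_points:
  assumes "finite A" "card A = Suc r"
  shows "real (card (box_points A t m))
    = (\<Sum>j\<le>Suc r. (-1)^j * real (Suc r choose j) * compositions r (m - int j * (int t + 1)))"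
  using assms
proof (induction r arbitrary: A m)
  case 0
  then obtain a where A: "A = {a}" by (metis One_nat_def card_1_singletonE)
  have "card (box_points A t m) = (\<Sum>i\<le>t. if i = nat m \<and> 0 \<le> m then 1 else 0)"
    unfolding A by (subst card_box_points_insert) (auto simp: box_points_empty intro!: sum.cong)
  also have "\<dots> = (if 0 \<le> m \<and> m \<le> int t then 1 else 0)"
    by (cases "0 \<le> m") auto
  finally show ?case
    by (auto simp: compositions_def poly_binom_poly)
next
  case (Suc r)
  then obtain a A' where A: "A = insert a A'" "a \<notin> A'" "card A' = Suc r" "finite A'"
    by (metis card_Suc_eq finite_insert)
  have "real (card (box_points A t m)) = (\<Sum>i\<le>t. \<Sum>j\<le>Suc r.
      (-1)^j * real (Suc r choose j) * compositions r (m - int j * (int t + 1) - int i))"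
    using A by (simp add: card_box_points_insert Suc.IH algebra_simps del: sum.atMost_Suc)
  also have "\<dots> = (\<Sum>j\<le>Suc r. (-1)^j * real (Suc r choose j)
      * (\<Sum>i\<le>t. compositions r (m - int j * (int t + 1) - int i)))"
    by (subst sum.swap) (simp add: sum_distrib_left del: sum.atMost_Suc)
  \<comment> \<open>The sum over the new coordinate telescopes, and its lower end is the argument
    belonging to \<open>Suc j\<close>.\<close>
  also have "\<dots> = (\<Sum>j\<le>Suc r. (-1)^j * real (Suc r choose j)
      * (compositions (Suc r) (m - int j * (int t + 1)) - compositions (Suc r) (m - int (Suc j) * (int t + 1))))"
    by (simp only: sum_compositions) (simp add: algebra_simps del: sum.atMost_Suc)
  also have "\<dots> = (\<Sum>j\<le>Suc (Suc r). (-1)^j * real (Suc (Suc r) choose j)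
      * compositions (Suc r) (m - int j * (int t + 1)))"
    by (rule alternating_sum_Suc)
  finally show ?case .
qed

text \<open>The cap \<open>t\<close> is inactive when the total is at most \<open>t\<close>: only
  \<open>j = 0\<close> leaves a nonnegative argument in the alternating sum.\<close>

corollary card_box_points_small:
  assumes "finite A" "card A = Suc r" "s \<le> t"
  shows "real (card (box_points A t (int s))) = poly (binom_poly r) (real s)"
proof -
  have "real (card (box_points A t (int s))) = (\<Sum>j\<le>Suc r. if j = 0 then compositions r (int s) else 0)"
    unfolding card_box_points[OF assms(1,2)]
  proof (intro sum.cong refl)
    fix j :: nat
    have "int s - int j * (int t + 1) < 0" if "0 < j"
    proof -
      have "1 * (int t + 1) \<le> int j * (int t + 1)" using that by (intro mult_right_mono) auto
      moreover have "int s < 1 * (int t + 1)" using assms(3) by simp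
      ultimately show ?thesis by linarith
    qed
    then show "(-1)^j * real (Suc r choose j) * compositions r (int s - int j * (int t + 1))
        = (if j = 0 then compositions r (int s) else 0)"
      by (auto simp: compositions_def)
  qed
  then show ?thesis by (simp add: compositions_def)
qed

text \<open>The \<open>j\<close>-th argument in the alternating sum is
  \<open>(k - j) * t - j\<close>. For \<open>j \<ge> k\<close> it is negative and the term drops out
  for all \<open>t\<close>. For \<open>j < k\<close> it is at least \<open>-r\<close>, and
  \<open>binom_poly r\<close> vanishes at -1, ..., -r, so the cutoff disappears and the term is a
  polynomial in \<open>t\<close>.\<close>

lemma ex_poly_card_box_points:
  assumes "finite A" "k \<le> card A"
  shows "\<exists>p. \<forall>t. poly p (real t) = real (card (box_points A t (int (k * t))))"
\<comment> \<open>For \<open>k = 0\<close> the term \<open>j = 0\<close> has argument 0 and would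
  not drop out; the box then holds only the zero point.\<close>
proof (cases "k = 0")
  case True
  have "f \<in> box_points A t 0 \<longleftrightarrow> f = (\<lambda>_. 0)" for t f
    using assms(1) by (auto simp: box_points_def fun_eq_iff simp flip: of_nat_sum)
  then have "box_points A t 0 = {\<lambda>_. 0}" for t by auto
  then show ?thesis using True by (intro exI[of _ 1]) simp
next
  case False
  then obtain r where r: "card A = Suc r" using assms(2) by (cases "card A") auto
  define p where "p = (\<Sum>j\<le>Suc r. if j < k then smult ((-1)^j * real (Suc r choose j))
    (pcompose (binom_poly r) [:- real j, real k - real j:]) else 0)"
  have "poly p (real t) = real (card (box_points A t (int (k * t))))" for t
    unfolding card_box_points[OF assms(1) r] p_def poly_sum
  proof (intro sum.cong refl)
    fix j
    define m where "m = int (k * t) - int j * (int t + 1)"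
    have "compositions r m = (if j < k then poly (binom_poly r) (of_int m) else 0)"
    proof (cases "j < k")
      case True
      have "int j * int t \<le> int k * int t" using True by (intro mult_right_mono) auto
      then have m: "- int r \<le> m"
        using True assms(2) r by (simp add: m_def algebra_simps)
      have "poly (binom_poly r) (of_int m) = 0" if "m < 0"
      proof -
        define l where "l = nat (m + int r)"
        have "real_of_int m + real r = real l" "l < r" using m that by (simp_all add: l_def)
        then show ?thesis
          by (simp add: poly_binom_poly binomial_eq_0 flip: binomial_gbinomial)
      qed
      then show ?thesis using True by (simp add: compositions_def)
    next
      case j: False
      then have "int k * int t \<le> int j * int t" by (intro mult_right_mono) auto
      then have "m < 0" using j False by (simp add: m_def algebra_simps)
      then show ?thesis using j by (simp add: compositions_def)
    qed
    then show "poly (if j < k then smult ((-1)^j * real (Suc r choose j))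
        (pcompose (binom_poly r) [:- real j, real k - real j:]) else 0) (real t)
      = (-1)^j * real (Suc r choose j) * compositions r (int (k * t) - int j * (int t + 1))"
      by (simp add: poly_pcompose m_def algebra_simps)
  qed
  then show ?thesis by blast
qed

section \<open>Slices of the box by the sum over a subset\<close>

text \<open>Replace \<open>f\<close> by \<open>t - f\<close> on \<open>X\<close>: the slice becomes the pairs of weak compositions of \<open>s\<close>, one
  supported on \<open>X\<close> and one on the complement.\<close>

lemma card_slice:
  assumes "finite E" "X \<subseteq> E" "card X = k"
  shows "card {f \<in> box_points E t (int (k * t)). sum f X + s = k * t}
    = card (box_points X t (int s)) * card (box_points (E - X) t (int s))"
proof -
  let ?S = "{f \<in> box_points E t (int (k * t)). sum f X + s = k * t}"
  let ?u = "\<lambda>f. (\<lambda>i. if i \<in> X then t - f i else 0, \<lambda>i. if i \<in> X then 0 else f i)"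
  let ?v = "\<lambda>(y, z) i. if i \<in> X then t - y i else z i"
  have finX: "finite X" using assms finite_subset by blast
  have complement: "(\<Sum>i\<in>X. t - f i) + sum f X = k * t" if "\<And>i. f i \<le> t" for f :: "'a \<Rightarrow> nat"
    using that assms by (simp flip: sum.distrib)
  have split: "sum f E = sum f X + sum f (E - X)" for f :: "'a \<Rightarrow> nat"
    using assms by (metis add.commute sum.subset_diff)
  have "bij_betw ?u ?S (box_points X t (int s) \<times> box_points (E - X) t (int s))"
  proof (rule bij_betw_byWitness[where f' = ?v])
    show "\<forall>f\<in>?S. ?v (?u f) = f"
      by (auto simp: box_points_def fun_eq_iff)
    show "\<forall>yz\<in>box_points X t (int s) \<times> box_points (E - X) t (int s). ?u (?v yz) = yz"
      by (auto simp: box_points_def fun_eq_iff)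
    show "?u ` ?S \<subseteq> box_points X t (int s) \<times> box_points (E - X) t (int s)"
    proof (intro image_subsetI)
      fix f assume f: "f \<in> ?S"
      then have "sum f E = k * t" "\<And>i. f i \<le> t" "sum f X + s = k * t"
        by (simp_all only: mem_Collect_eq box_points_iff)
      moreover have "(\<Sum>i\<in>E - X. if i \<in> X then 0 else f i) = sum f (E - X)"
        by (intro sum.cong) auto
      ultimately show "?u f \<in> box_points X t (int s) \<times> box_points (E - X) t (int s)"
        using f complement[of f] split[of f] by (auto simp: box_points_iff simp del: of_nat_mult)
    qed
    show "?v ` (box_points X t (int s) \<times> box_points (E - X) t (int s)) \<subseteq> ?S"
    proof (intro image_subsetI)
      fix yz assume "yz \<in> box_points X t (int s) \<times> box_points (E - X) t (int s)"
      then obtain y z where yz: "yz = (y, z)" "y \<in> box_points X t (int s)" "z \<in> box_points (E - X) t (int s)"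
        by blast
      have "sum (?v (y, z)) (E - X) = sum z (E - X)" by (intro sum.cong) auto
      moreover have "sum (?v (y, z)) X = (\<Sum>i\<in>X. t - y i)" by (intro sum.cong) auto
      ultimately have "sum (?v (y, z)) X + s = k * t" "sum (?v (y, z)) E = k * t"
        using yz complement[of y] split[of "?v (y, z)"] by (auto simp: box_points_iff)
      then show "?v yz \<in> ?S"
        using yz assms(2) by (auto simp: box_points_iff simp del: of_nat_mult)
    qed
  qed
  then show ?thesis by (simp add: bij_betw_same_card card_cartesian_product)
qed

lemma real_card_slice:
  assumes "finite E" "X \<subseteq> E" "card X = Suc a" "card E = Suc a + Suc b" "s \<le> t"
  shows "real (card {f \<in> box_points E t (int (Suc a * t)). sum f X + s = Suc a * t})
    = poly (binom_poly a * binom_poly b) (real s)"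
proof -
  have "finite X" "card (E - X) = Suc b"
    using assms finite_subset[of X E] by (auto simp: card_Diff_subset)
  then show ?thesis
    using assms by (simp only: card_slice) (simp add: card_box_points_small)
qed

text \<open>The bound \<open>u\<close> serves two uses: \<open>u = t\<close> for the points
  violating the inequality of a circuit-hyperplane, and \<open>u = Suc t\<close> for the minimal
  matroid. Each slice has \<open>s \<le> t\<close>, where the cap is inactive.\<close>

lemma real_card_slices:
  assumes "finite E" "X \<subseteq> E" "card X = Suc a" "card E = Suc a + Suc b" "u \<le> Suc t"
  shows "real (card {f \<in> box_points E t (int (Suc a * t)). Suc a * t < sum f X + u})
    = (\<Sum>s<u. poly (binom_poly a * binom_poly b) (real s))"
proof -
  let ?S = "\<lambda>s. {f \<in> box_points E t (int (Suc a * t)). sum f X + s = Suc a * t}"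
  have "sum f X \<le> Suc a * t" if "f \<in> box_points E t (int (Suc a * t))" for f
  proof -
    have "sum f X \<le> sum f E" using assms by (intro sum_mono2) auto
    also have "\<dots> = Suc a * t" using that by (simp only: box_points_iff)
    finally show ?thesis .
  qed
  then have "f \<in> ?S (Suc a * t - sum f X) \<and> Suc a * t - sum f X < u"
    if "f \<in> box_points E t (int (Suc a * t))" "Suc a * t < sum f X + u" for f
    using that by (simp add: less_diff_conv2 add.commute del: of_nat_mult mult_Suc)
  then have "{f \<in> box_points E t (int (Suc a * t)). Suc a * t < sum f X + u} = (\<Union>s\<in>{..<u}. ?S s)"
    by (intro equalityI subsetI) (blast, force simp del: of_nat_mult mult_Suc)
  moreover have "card (\<Union>s\<in>{..<u}. ?S s) = (\<Sum>s<u. card (?S s))"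
    by (intro card_UN_disjoint) (auto simp: finite_box_points assms(1) simp del: of_nat_mult)
  moreover have "real (card (?S s)) = poly (binom_poly a * binom_poly b) (real s)" if "s < u" for s
    using that assms by (intro real_card_slice) auto
  ultimately show ?thesis by simp
qed

subsection \<open>Integer points of base polytopes\<close>

lemma lookup_scaleR: "Poly_Mapping.lookup (r *\<^sub>R x) i = r *\<^sub>R Poly_Mapping.lookup x i"
proof -
  have "finite {i. r *\<^sub>R Poly_Mapping.lookup x i \<noteq> 0}"
    by (rule finite_subset[OF _ finite_keys[of x]]) (auto simp: in_keys_iff)
  then show ?thesis by (simp add: scaleR_poly_mapping_def Abs_poly_mapping_inverse)
qed

lemma lookup_indicator_vector:
  "finite B \<Longrightarrow> Poly_Mapping.lookup (indicator_vector B) i = of_bool (i \<in> B)"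
  by (simp add: indicator_vector_def lookup_sum lookup_single when_def if_distrib sum.delta' cong: if_cong)

lemma sum_lookup_indicator_vector:
  assumes "finite B" "finite S"
  shows "(\<Sum>i\<in>S. Poly_Mapping.lookup (indicator_vector B) i) = real (card (B \<inter> S))"
  using assms by (simp add: lookup_indicator_vector Int_commute flip: sum.inter_filter Int_def)

text \<open>A half-space is convex, so a bound at the vertices passes to their hull.\<close>

lemma base_polytope_sum_le:
  assumes "\<And>B. B \<in> bases M \<Longrightarrow> finite B" "finite S" "x \<in> base_polytope M"
    and "\<And>B. B \<in> bases M \<Longrightarrow> real (card (B \<inter> S)) \<le> c"
  shows "(\<Sum>i\<in>S. Poly_Mapping.lookup x i) \<le> c"
proof -
  have "convex {x. (\<Sum>i\<in>S. Poly_Mapping.lookup x i) \<le> c}"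
    by (rule convexI) (simp add: lookup_add lookup_scaleR sum.distrib convex_bound_le flip: sum_distrib_left)
  then have "base_polytope M \<subseteq> {x. (\<Sum>i\<in>S. Poly_Mapping.lookup x i) \<le> c}"
    unfolding base_polytope_def
    using assms by (intro hull_minimal) (auto simp: sum_lookup_indicator_vector)
  then show ?thesis using assms(3) by blast
qed

lemma base_polytope_sum_ge:
  assumes "\<And>B. B \<in> bases M \<Longrightarrow> finite B" "finite S" "x \<in> base_polytope M"
    and "\<And>B. B \<in> bases M \<Longrightarrow> c \<le> real (card (B \<inter> S))"
  shows "c \<le> (\<Sum>i\<in>S. Poly_Mapping.lookup x i)"
proof -
  have "convex {x. - (\<Sum>i\<in>S. Poly_Mapping.lookup x i) \<le> - c}"
  proof (rule convexI)
    fix x y :: "'a \<Rightarrow>\<^sub>0 real" and u v :: real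
    assume "x \<in> {x. - (\<Sum>i\<in>S. Poly_Mapping.lookup x i) \<le> - c}"
      "y \<in> {x. - (\<Sum>i\<in>S. Poly_Mapping.lookup x i) \<le> - c}" "0 \<le> u" "0 \<le> v" "u + v = 1"
    then show "u *\<^sub>R x + v *\<^sub>R y \<in> {x. - (\<Sum>i\<in>S. Poly_Mapping.lookup x i) \<le> - c}"
      using convex_bound_le[of "- (\<Sum>i\<in>S. Poly_Mapping.lookup x i)" "-c" "- (\<Sum>i\<in>S. Poly_Mapping.lookup y i)" u v]
      by (simp add: lookup_add lookup_scaleR sum.distrib flip: sum_distrib_left)
  qed
  then have "base_polytope M \<subseteq> {x. - (\<Sum>i\<in>S. Poly_Mapping.lookup x i) \<le> - c}"
    unfolding base_polytope_def
    using assms by (intro hull_minimal) (auto simp: sum_lookup_indicator_vector)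
  then show ?thesis using assms(3) by auto
qed

text \<open>The sum of the indicator vectors of \<open>B 0\<close>, ..., \<open>B (t - 1)\<close>:
  the shape of an integer point in the dilate that splits into \<open>t\<close> vertices.\<close>

definition multi_union :: "nat \<Rightarrow> (nat \<Rightarrow> 'a set) \<Rightarrow> 'a \<Rightarrow> nat" where
  "multi_union t B i = (\<Sum>j<t. of_bool (i \<in> B j))"

lemma sum_multi_union:
  assumes "finite S"
  shows "sum (multi_union t B) S = (\<Sum>j<t. card (B j \<inter> S))"
proof -
  have "sum (multi_union t B) S = (\<Sum>j<t. \<Sum>i\<in>S. of_bool (i \<in> B j))"
    unfolding multi_union_def by (rule sum.swap)
  then show ?thesis using assms by (simp add: Int_commute flip: sum.inter_filter Int_def)
qed

lemma multi_union_eq_0: "(\<And>j. j < t \<Longrightarrow> i \<notin> B j) \<Longrightarrow> multi_union t B i = 0"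
  by (simp add: multi_union_def)

lemma multi_union_Suc: "multi_union (Suc t) (B(t := A)) i = multi_union t B i + of_bool (i \<in> A)"
  by (simp add: multi_union_def)

text \<open>The integer points of a dilate of the base polytope are those of \<open>F\<close> as soon as all of \<open>F\<close> is a
  sum of \<open>t\<close> bases, and \<open>F\<close> is cut out by inequalities on partial sums that every basis satisfies.\<close>

lemma lattice_count_eqI:
  assumes fin: "finite (ground M)" and sub: "\<And>B. B \<in> bases M \<Longrightarrow> B \<subseteq> ground M"
    and ne: "bases M \<noteq> {}"
    and decompose: "\<And>f. f \<in> F \<Longrightarrow> \<exists>B. (\<forall>j<t. B j \<in> bases M) \<and> f = multi_union t B"
    and cut: "\<And>f :: 'a \<Rightarrow> nat. \<lbrakk>\<And>i. i \<notin> ground M \<Longrightarrow> f i = 0;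
      \<And>S c. \<lbrakk>finite S; \<And>B. B \<in> bases M \<Longrightarrow> card (B \<inter> S) \<le> c\<rbrakk> \<Longrightarrow> sum f S \<le> c * t;
      \<And>S c. \<lbrakk>finite S; \<And>B. B \<in> bases M \<Longrightarrow> c \<le> card (B \<inter> S)\<rbrakk> \<Longrightarrow> c * t \<le> sum f S\<rbrakk> \<Longrightarrow> f \<in> F"
  shows "lattice_count M t = card F"
proof -
  let ?P = "(\<lambda>x. real t *\<^sub>R x) ` base_polytope M \<inter> integer_points (ground M)"
  \<comment> \<open>The rounding is exact on \<open>?P\<close>, whose points have nonnegative
    integer coordinates.\<close>
  let ?v = "\<lambda>x i. nat \<lfloor>Poly_Mapping.lookup x i\<rfloor>"
  have finB: "finite B" if "B \<in> bases M" for B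
    using that sub fin finite_subset by blast
  have point: "?v x \<in> F \<and> (\<forall>i. Poly_Mapping.lookup x i = real (?v x i))" if x: "x \<in> ?P" for x
  proof -
    obtain y where y: "y \<in> base_polytope M" "x = real t *\<^sub>R y" using x by blast
    have le: "(\<Sum>i\<in>S. Poly_Mapping.lookup x i) \<le> real (c * t)"
      if "finite S" "\<And>B. B \<in> bases M \<Longrightarrow> card (B \<inter> S) \<le> c" for S c
    proof -
      have "(\<Sum>i\<in>S. Poly_Mapping.lookup y i) \<le> real c"
        by (rule base_polytope_sum_le[OF finB that(1) y(1)]) (use that in auto)
      from mult_left_mono[OF this, of "real t"] show ?thesis
        by (simp add: y lookup_scaleR mult.commute flip: sum_distrib_left)
    qed
    have ge: "real (c * t) \<le> (\<Sum>i\<in>S. Poly_Mapping.lookup x i)"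
      if "finite S" "\<And>B. B \<in> bases M \<Longrightarrow> c \<le> card (B \<inter> S)" for S c
    proof -
      have "real c \<le> (\<Sum>i\<in>S. Poly_Mapping.lookup y i)"
        by (rule base_polytope_sum_ge[OF finB that(1) y(1)]) (use that in auto)
      from mult_left_mono[OF this, of "real t"] show ?thesis
        by (simp add: y lookup_scaleR mult.commute flip: sum_distrib_left)
    qed
    have nonneg: "0 \<le> Poly_Mapping.lookup x i" for i using ge[of "{i}" 0] by simp
    have int: "Poly_Mapping.lookup x i \<in> \<int>" for i using x by (simp add: integer_points_def)
    have v: "Poly_Mapping.lookup x i = real (?v x i)" for i
      using nonneg[of i] int[of i] by (auto elim!: Ints_cases)
    have sum_v: "(\<Sum>i\<in>S. Poly_Mapping.lookup x i) = real (sum (?v x) S)" for S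
      using v by simp
    have "?v x \<in> F"
    proof (rule cut)
      show "?v x i = 0" if "i \<notin> ground M" for i
      proof -
        have "i \<notin> Poly_Mapping.keys x" using x that by (auto simp: integer_points_def)
        then show ?thesis by (simp add: in_keys_iff)
      qed
      show "sum (?v x) S \<le> c * t" if "finite S" "\<And>B. B \<in> bases M \<Longrightarrow> card (B \<inter> S) \<le> c" for S c
        using le[OF that] unfolding sum_v of_nat_le_iff .
      show "c * t \<le> sum (?v x) S" if "finite S" "\<And>B. B \<in> bases M \<Longrightarrow> c \<le> card (B \<inter> S)" for S c
        using ge[OF that] unfolding sum_v of_nat_le_iff .
    qed
    then show ?thesis using v by blast
  qed
  have "bij_betw ?v ?P F"
  proof (rule bij_betw_imageI)
    show "inj_on ?v ?P"
      using point by (intro inj_onI poly_mapping_eqI) metis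
    show "?v ` ?P = F"
    proof (intro equalityI subsetI)
      show "f \<in> F" if "f \<in> ?v ` ?P" for f using that point by blast
    next
      fix f assume "f \<in> F"
      then obtain B where B: "\<And>j. j < t \<Longrightarrow> B j \<in> bases M" "f = multi_union t B"
        using decompose by blast
      define x where "x = (\<Sum>j<t. indicator_vector (B j))"
      have lookup: "Poly_Mapping.lookup x i = real (f i)" for i
        using B finB by (simp add: x_def lookup_sum lookup_indicator_vector multi_union_def)
      have f0: "f i = 0" if "i \<notin> ground M" for i
        using that sub[OF B(1)] unfolding B(2) by (intro multi_union_eq_0) blast
      have "x \<in> (\<lambda>x. real t *\<^sub>R x) ` base_polytope M"
      \<comment> \<open>For positive \<open>t\<close> the point is \<open>t\<close> times the
        average of the chosen vertices. For \<open>t = 0\<close> there is no average, and dilation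
        sends any vertex to the zero vector.\<close>
      proof (cases "t = 0")
        case True
        obtain A where "A \<in> bases M" using ne by blast
        then have "indicator_vector A \<in> base_polytope M"
          unfolding base_polytope_def by (intro hull_inc) blast
        moreover have "x = real t *\<^sub>R indicator_vector A" using True by (simp add: x_def)
        ultimately show ?thesis by blast
      next
        case False
        have "(\<Sum>j<t. (1 / real t) *\<^sub>R indicator_vector (B j)) \<in> base_polytope M"
          unfolding base_polytope_def
          by (rule convex_sum) (use False B(1) in \<open>auto intro: hull_inc\<close>)
        moreover have "x = real t *\<^sub>R (\<Sum>j<t. (1 / real t) *\<^sub>R indicator_vector (B j))"
          using False by (simp add: x_def flip: scaleR_sum_right)
        ultimately show ?thesis by blast
      qed
      moreover have "x \<in> integer_points (ground M)"
        using f0 by (fastforce simp: integer_points_def lookup in_keys_iff)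
      moreover have "?v x = f" by (simp add: lookup fun_eq_iff)
      ultimately show "f \<in> ?v ` ?P" by blast
    qed
  qed
  then show ?thesis by (simp add: lattice_count_def bij_betw_same_card)
qed

section \<open>Decomposing integer points into bases\<close>

text \<open>Greedy removal: \<open>A\<close> must contain the set \<open>L\<close> of coordinates at
  the cap and stay inside the set \<open>U\<close> of positive ones. The total
  \<open>k * Suc t\<close> forces \<open>card L \<le> k \<le> card U\<close>, so such an
  \<open>A\<close> of size \<open>k\<close> exists, and removing it lowers the cap to
  \<open>t\<close>.\<close>

lemma box_points_decompose:
  assumes "finite E" "f \<in> box_points E t (int (k * t))"
  shows "\<exists>B. (\<forall>j<t. B j \<subseteq> E \<and> card (B j) = k) \<and> f = multi_union t B"
  using assms(2)
proof (induction t arbitrary: f)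
  case 0
  then show ?case by (auto simp: box_points_def multi_union_def fun_eq_iff)
next
  case (Suc t)
  then have f: "\<And>i. i \<notin> E \<Longrightarrow> f i = 0" "\<And>i. f i \<le> Suc t" "sum f E = k * Suc t"
    unfolding box_points_iff by blast+
  define L where "L = {i \<in> E. f i = Suc t}"
  define U where "U = {i \<in> E. 0 < f i}"
  have LU: "L \<subseteq> U" "U \<subseteq> E" by (auto simp: L_def U_def)
  have finU: "finite U" using LU(2) assms(1) finite_subset by blast
  have finL: "finite L" using LU(1) finU finite_subset by blast
  have "card L * Suc t = sum f L" by (simp add: L_def)
  also have "\<dots> \<le> sum f E" using assms(1) LU by (intro sum_mono2) auto
  finally have L: "card L \<le> k" using f(3) by (metis Suc_mult_le_cancel1 mult.commute)
  have "sum f E = sum f U"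
    using assms(1) by (intro sum.mono_neutral_right) (auto simp: U_def)
  also have "\<dots> \<le> card U * Suc t" using f(2) sum_bounded_above[of U f "Suc t"] by simp
  finally have U: "k \<le> card U" using f(3) by (metis Suc_mult_le_cancel1 mult.commute)
  obtain A where A: "L \<subseteq> A" "A \<subseteq> U" "card A = k"
    using exists_subset_between[OF L U LU(1) finU] by blast
  define g where "g i = f i - of_bool (i \<in> A)" for i
  have fg: "f i = g i + of_bool (i \<in> A)" for i
    using A(2) by (auto simp: g_def U_def)
  have AE: "A \<subseteq> E" using A LU by blast
  have "sum f E = sum g E + card (E \<inter> A)"
    using assms(1) by (simp add: fg sum.distrib flip: sum.inter_filter Int_def)
  then have "sum g E = k * t"
    using f(3) A(3) AE by (simp add: inf_absorb2)
  moreover have "g i \<le> t" for i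
  proof (cases "i \<in> A")
    case False
    then have "f i \<noteq> Suc t" using A(1) f(1)[of i] unfolding L_def by fastforce
    then show ?thesis using f(2)[of i] by (simp add: g_def)
  qed (use f(2)[of i] in \<open>simp add: g_def\<close>)
  ultimately have "g \<in> box_points E t (int (k * t))"
    using f(1) unfolding box_points_iff by (simp add: g_def)
  then obtain B where B: "\<And>j. j < t \<Longrightarrow> B j \<subseteq> E \<and> card (B j) = k" "g = multi_union t B"
    using Suc.IH by blast
  have "f = multi_union (Suc t) (B(t := A))"
    by (simp add: fun_eq_iff multi_union_Suc fg B(2))
  moreover have "(B(t := A)) j \<subseteq> E \<and> card ((B(t := A)) j) = k" if "j < Suc t" for j
    using that B(1)[of j] A(3) AE by (cases "j = t") auto
  ultimately show ?case by blast
qed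

text \<open>Take a decomposition into \<open>k\<close>-sets with the fewest members of \<open>N\<close>. If it uses \<open>X \<in> N\<close>, the
  inequality for \<open>X\<close> provides another part \<open>Y\<close> with \<open>|Y \<inter> X| \<le> k - 2\<close>. An exchange of \<open>a \<in> X - Y\<close> and
  \<open>b \<in> Y - X\<close> takes \<open>X\<close> out of \<open>N\<close>, and for fixed \<open>b\<close> at most one choice of \<open>a\<close> puts \<open>Y\<close> into \<open>N\<close>.\<close>

lemma nonadjacent_decompose:
  assumes "finite E"
    and N: "\<And>X. X \<in> N \<Longrightarrow> X \<subseteq> E \<and> card X = k"
    and nonadjacent: "\<And>X a b. \<lbrakk>X \<in> N; a \<in> X; b \<in> E - X\<rbrakk> \<Longrightarrow> insert b (X - {a}) \<notin> N"
    and f: "f \<in> box_points E t (int (k * t))"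
    and cut: "\<And>X. X \<in> N \<Longrightarrow> sum f X + t \<le> k * t"
  shows "\<exists>B. (\<forall>j<t. B j \<subseteq> E \<and> card (B j) = k \<and> B j \<notin> N) \<and> f = multi_union t B"
proof -
  define good where
    "good B \<longleftrightarrow> (\<forall>j<t. B j \<subseteq> E \<and> card (B j) = k) \<and> f = multi_union t B" for B
  define bad where "bad B = {j. j < t \<and> B j \<in> N}" for B
  obtain B0 where "good B0"
    using box_points_decompose[OF assms(1) f] unfolding good_def by blast
  from ex_has_least_nat[of good, OF this, of "\<lambda>B. card (bad B)"]
  obtain B where B: "good B" "\<And>B'. good B' \<Longrightarrow> card (bad B) \<le> card (bad B')"
    by blast
  have "B p \<notin> N" if p: "p < t" for p
  proof
    assume XN: "B p \<in> N"
    define X where "X = B p"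
    have X: "X \<subseteq> E" "card X = k" "finite X"
      using N[OF XN] finite_subset[OF _ assms(1)] unfolding X_def by simp_all
    have Bj: "B j \<subseteq> E" "card (B j) = k" "finite (B j)" if "j < t" for j
      using that B(1) finite_subset[OF _ assms(1)] unfolding good_def by simp_all
    \<comment> \<open>Otherwise every part meets \<open>X\<close> in at least \<open>k - 1\<close>
      elements and part \<open>p\<close> in \<open>k\<close>, so the sum of \<open>f\<close> over
      \<open>X\<close> exceeds the bound in \<open>cut\<close>.\<close>
    have "\<exists>q<t. card (B q \<inter> X) + 2 \<le> k"
    proof (rule ccontr)
      assume "\<not> ?thesis"
      then have ge: "k \<le> card (B j \<inter> X) + 1" if "j < t" for j
        using that by force
      have "k * t = (\<Sum>j<t. k)" by simp
      also have "\<dots> < (\<Sum>j<t. card (B j \<inter> X) + 1)"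
        using p ge X by (intro sum_strict_mono_ex1) (auto simp: X_def intro!: bexI[of _ p])
      also have "\<dots> = sum f X + t"
        using B(1) sum_multi_union[OF X(3), of t B] by (simp add: good_def sum_Suc)
      finally show False using cut[OF XN] by (simp add: X_def)
    qed
    then obtain q where q: "q < t" "card (B q \<inter> X) + 2 \<le> k" by blast
    define Y where "Y = B q"
    have Y: "Y \<subseteq> E" "card Y = k" "finite Y" using Bj[OF q(1)] by (simp_all add: Y_def)
    have XY: "card (X - Y) \<ge> 2" "card (Y - X) \<ge> 2"
      using q(2) X Y by (simp_all add: Y_def card_Diff_subset_Int Int_commute)
    have pq: "p \<noteq> q" using q(2) X by (auto simp: X_def)
    have "Y - X \<noteq> {}" using XY(2) by (metis card.empty not_numeral_le_zero)
    then obtain b where b: "b \<in> Y - X" by blast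
    obtain a where a: "a \<in> X - Y" "insert a (Y - {b}) \<notin> N"
    proof -
      obtain a a' where aa': "a \<in> X - Y" "a' \<in> X - Y" "a \<noteq> a'"
        using XY(1) card_le_Suc0_iff_eq[of "X - Y"] X(3) by force
      \<comment> \<open>The two candidates for the new \<open>Y\<close> differ by exchanging
        \<open>a\<close> for \<open>a'\<close>, so \<open>N\<close> cannot contain both.\<close>
      have "insert a' (insert a (Y - {b}) - {a}) = insert a' (Y - {b})"
        using aa' by auto
      then have "insert a (Y - {b}) \<notin> N \<or> insert a' (Y - {b}) \<notin> N"
        using nonadjacent[of "insert a (Y - {b})" a a'] aa' X(1) by fastforce
      then show thesis using that aa' by blast
    qed
    define B' where "B' = B(p := insert b (X - {a}), q := insert a (Y - {b}))"
    have B'q: "B' q = insert a (Y - {b})" and B'p: "B' p = insert b (X - {a})"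
      using pq by (simp_all add: B'_def)
    have "insert b (X - {a}) \<notin> N"
      using nonadjacent[OF XN] a b Y(1) unfolding X_def by blast
    have "multi_union t B' = multi_union t B"
    proof
      fix i :: 'a
      have split: "multi_union t C i = of_bool (i \<in> C p) + of_bool (i \<in> C q)
          + (\<Sum>j\<in>{..<t} - {p} - {q}. of_bool (i \<in> C j))" for C :: "nat \<Rightarrow> 'a set"
        using p q(1) pq by (simp add: multi_union_def sum.remove[of "{..<t}" p] sum.remove[of "{..<t} - {p}" q] del: sum_of_bool_eq)
      have "(\<Sum>j\<in>{..<t} - {p} - {q}. of_bool (i \<in> B' j)) = (\<Sum>j\<in>{..<t} - {p} - {q}. of_bool (i \<in> B j) :: nat)"
        by (intro sum.cong) (auto simp: B'_def)
      moreover have "of_bool (i \<in> B' p) + of_bool (i \<in> B' q) = (of_bool (i \<in> B p) + of_bool (i \<in> B q) :: nat)"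
        unfolding B'p B'q using a(1) b by (auto simp flip: X_def Y_def)
      ultimately show "multi_union t B' i = multi_union t B i"
        unfolding split by simp
    qed
    moreover have "B' j \<subseteq> E \<and> card (B' j) = k" if "j < t" for j
    proof -
      have "card (insert b (X - {a})) = k" "card (insert a (Y - {b})) = k"
        using a(1) b X Y card_Suc_Diff1[of X a] card_Suc_Diff1[of Y b] by simp_all
      moreover have "insert b (X - {a}) \<subseteq> E" "insert a (Y - {b}) \<subseteq> E"
        using a(1) b X(1) Y(1) by auto
      ultimately show ?thesis using Bj[OF that] by (simp add: B'_def)
    qed
    ultimately have "good B'" using B(1) by (simp add: good_def)
    \<comment> \<open>The index \<open>p\<close> leaves the bad set and \<open>q\<close> does not
      enter it, against minimality.\<close>
    moreover have "bad B' \<subseteq> bad B - {p}"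
      using \<open>insert b (X - {a}) \<notin> N\<close> a(2) pq by (auto simp: bad_def B'_def split: if_splits)
    then have "card (bad B') < card (bad B)"
      using p XN by (intro psubset_card_mono) (auto simp: bad_def)
    ultimately show False using B(2) by (meson not_less)
  qed
  then show ?thesis using B(1) unfolding good_def by blast
qed

text \<open>A \<open>k\<close>-set outside \<open>N\<close> meets each \<open>X\<close> in
  \<open>N\<close> in at most \<open>k - 1\<close> elements, so the inequalities are necessary; the
  decomposition makes them sufficient. Empty \<open>N\<close> gives the uniform matroid.\<close>

lemma lattice_count_nonadjacent:
  assumes fin: "finite E" and ne: "bases M \<noteq> {}"
    and ground: "ground M = E" and bases: "bases M = {B. B \<subseteq> E \<and> card B = k \<and> B \<notin> N}"
    and N: "\<And>X. X \<in> N \<Longrightarrow> X \<subseteq> E \<and> card X = k" and "N \<noteq> {} \<Longrightarrow> 0 < k"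
    and nonadjacent: "\<And>X a b. \<lbrakk>X \<in> N; a \<in> X; b \<in> E - X\<rbrakk> \<Longrightarrow> insert b (X - {a}) \<notin> N"
  shows "lattice_count M t
    = card {f \<in> box_points E t (int (k * t)). \<forall>X\<in>N. sum f X + t \<le> k * t}"
proof (rule lattice_count_eqI)
  fix f assume "f \<in> {f \<in> box_points E t (int (k * t)). \<forall>X\<in>N. sum f X + t \<le> k * t}"
  then show "\<exists>B. (\<forall>j<t. B j \<in> bases M) \<and> f = multi_union t B"
    using nonadjacent_decompose[OF fin N nonadjacent, of f t] unfolding bases by auto
next
  fix f :: "'a \<Rightarrow> nat"
  assume f0: "\<And>i. i \<notin> ground M \<Longrightarrow> f i = 0"
    and le: "\<And>S c. \<lbrakk>finite S; \<And>B. B \<in> bases M \<Longrightarrow> card (B \<inter> S) \<le> c\<rbrakk> \<Longrightarrow> sum f S \<le> c * t"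
    and ge: "\<And>S c. \<lbrakk>finite S; \<And>B. B \<in> bases M \<Longrightarrow> c \<le> card (B \<inter> S)\<rbrakk> \<Longrightarrow> c * t \<le> sum f S"
  have BE: "card (B \<inter> E) = k" if "B \<in> bases M" for B
    using that unfolding bases by (simp add: inf_absorb1)
  have "sum f E = k * t"
    using le[of E k] ge[of E k] fin BE by (intro antisym) auto
  moreover have "f i \<le> t" for i
    using le[of "{i}" 1] by (simp add: card_insert_if Int_insert_right)
  moreover have "sum f X + t \<le> k * t" if X: "X \<in> N" for X
  proof -
    have "card (B \<inter> X) \<le> k - 1" if B: "B \<in> bases M" for B
    proof -
      have "finite X" "card X = k" using N[OF X] finite_subset[OF _ fin] by simp_all
      moreover have "B \<inter> X \<noteq> X"
      proof
        assume "B \<inter> X = X"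
        then have "X \<subseteq> B" by blast
        moreover have "finite B" "card B = k" "B \<notin> N" using B finite_subset[OF _ fin] unfolding bases by simp_all
        ultimately have "X = B" using \<open>card X = k\<close> by (intro card_subset_eq) auto
        then show False using X \<open>B \<notin> N\<close> by blast
      qed
      ultimately have "card (B \<inter> X) < k" using psubset_card_mono[of X "B \<inter> X"] by blast
      then show ?thesis by simp
    qed
    then have "sum f X \<le> (k - 1) * t"
      using N[OF X] finite_subset[OF _ fin] by (intro le) simp_all
    moreover have "(k - 1) * t + t = k * t" using assms(6) X by (cases k) auto
    ultimately show ?thesis by linarith
  qed
  ultimately show "f \<in> {f \<in> box_points E t (int (k * t)). \<forall>X\<in>N. sum f X + t \<le> k * t}"
    using f0 ground by (simp only: mem_Collect_eq box_points_iff) blast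
qed (use fin ne ground bases in auto)

section \<open>Bases at most one exchange away from a fixed set\<close>

lemma multi_union_truncate:
  assumes "s \<le> t"
  shows "multi_union s B i = (\<Sum>j<t. of_bool (j < s \<and> i \<in> B j))"
  unfolding multi_union_def
  using assms by (intro sum.mono_neutral_cong_left) auto

text \<open>The deficits \<open>t - f\<close> on \<open>X\<close> and the values of \<open>f\<close>
  off \<open>X\<close> have the same total \<open>s \<le> t\<close>. Splitting both into
  \<open>s\<close> single elements and pairing these gives \<open>s\<close> exchanges; the other
  \<open>t - s\<close> parts are \<open>X\<close> itself.\<close>

lemma one_exchange_decompose:
  assumes fin: "finite E" and X: "X \<subseteq> E" "card X = k"
    and f: "f \<in> box_points E t (int (k * t))" and ge: "k * t \<le> sum f X + t"
  shows "\<exists>B. (\<forall>j<t. B j \<in> insert X {insert b (X - {a}) | a b. a \<in> X \<and> b \<in> E - X}) \<and> f = multi_union t B"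
proof -
  have finX: "finite X" using X fin finite_subset by blast
  have f': "\<And>i. i \<notin> E \<Longrightarrow> f i = 0" "\<And>i. f i \<le> t" "sum f E = k * t"
    using f unfolding box_points_iff by blast+
  define s where "s = sum f (E - X)"
  define y where "y i = (if i \<in> X then t - f i else 0)" for i
  define z where "z i = (if i \<in> X then 0 else f i)" for i
  have split: "sum f X + s = k * t"
    using sum.subset_diff[OF X(1) fin, of f] f'(3) by (simp add: s_def)
  have "sum y X + sum f X = (\<Sum>i\<in>X. t)"
    unfolding sum.distrib[symmetric] using f'(2) by (intro sum.cong) (auto simp: y_def)
  then have sum_y: "sum y X = s" using split X(2) by simp
  have sum_z: "sum z (E - X) = s"
    unfolding s_def by (intro sum.cong) (auto simp: z_def)
  have st: "s \<le> t" using split ge by simp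
  have y_le: "y i \<le> s" for i
  proof (cases "i \<in> X")
    case True
    then show ?thesis using member_le_sum[of i X y] finX sum_y by simp
  qed (simp add: y_def)
  have z_le: "z i \<le> s" for i
  proof (cases "i \<in> E - X")
    case True
    then show ?thesis using member_le_sum[of i "E - X" z] fin sum_z by simp
  qed (use f'(1) in \<open>auto simp: z_def\<close>)
  \<comment> \<open>Entries are bounded by the total \<open>s\<close>, so the decomposition into
    1-sets applies with \<open>s\<close> as the cap.\<close>
  have "y \<in> box_points X s (int (1 * s))" "z \<in> box_points (E - X) s (int (1 * s))"
    unfolding box_points_iff using sum_y sum_z y_le z_le f'(1) by (auto simp: y_def z_def)
  then obtain Y Z where Y: "\<And>j. j < s \<Longrightarrow> Y j \<subseteq> X \<and> card (Y j) = 1" "y = multi_union s Y"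
    and Z: "\<And>j. j < s \<Longrightarrow> Z j \<subseteq> E - X \<and> card (Z j) = 1" "z = multi_union s Z"
    using box_points_decompose[OF finX, of y s 1] box_points_decompose[of "E - X" z s 1] fin
    by (metis finite_Diff)
  define B where "B j = (if j < s then (X - Y j) \<union> Z j else X)" for j
  have "B j \<in> insert X {insert b (X - {a}) | a b. a \<in> X \<and> b \<in> E - X}" for j
  proof (cases "j < s")
    case True
    obtain a b where ab: "Y j = {a}" "Z j = {b}"
      using Y(1)[OF True] Z(1)[OF True] by (meson card_1_singletonE)
    then have "a \<in> X" "b \<in> E - X" "B j = insert b (X - {a})"
      using Y(1)[OF True] Z(1)[OF True] True by (auto simp: B_def)
    then show ?thesis by blast
  qed (simp add: B_def)
  moreover have "f i = multi_union t B i" for i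
  proof (cases "i \<in> X")
    case True
    \<comment> \<open>For \<open>i\<close> in \<open>X\<close>, each of the \<open>t\<close> parts
      either contains \<open>i\<close> or has exchanged it away.\<close>
    have "multi_union t B i + y i = (\<Sum>j<t. of_bool (i \<in> B j) + of_bool (j < s \<and> i \<in> Y j))"
      unfolding Y(2) multi_union_truncate[OF st] by (simp only: multi_union_def sum.distrib)
    also have "\<dots> = (\<Sum>j<t. 1)"
      using True Z(1) by (intro sum.cong) (auto simp: B_def)
    finally show ?thesis using True f'(2)[of i] by (simp add: y_def)
  next
    case False
    have "multi_union t B i = z i"
      unfolding Z(2) multi_union_truncate[OF st] unfolding multi_union_def
      using False Y(1) by (intro sum.cong) (auto simp: B_def)
    then show ?thesis using False by (simp add: z_def)
  qed
  ultimately show ?thesis by blast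
qed

text \<open>Each basis meets \<open>X\<close> in at least \<open>k - 1\<close> elements, so
  \<open>k * t \<le> sum f X + t\<close> is necessary. The strict form with \<open>Suc t\<close>
  fits \<open>real_card_slices\<close>.\<close>

lemma lattice_count_one_exchange:
  assumes fin: "finite E" and X: "X \<subseteq> E" "card X = k"
    and ground: "ground M = E"
    and bases: "bases M = insert X {insert b (X - {a}) | a b. a \<in> X \<and> b \<in> E - X}"
  shows "lattice_count M t = card {f \<in> box_points E t (int (k * t)). k * t < sum f X + Suc t}"
proof (rule lattice_count_eqI)
  fix f assume "f \<in> {f \<in> box_points E t (int (k * t)). k * t < sum f X + Suc t}"
  then show "\<exists>B. (\<forall>j<t. B j \<in> bases M) \<and> f = multi_union t B"
    unfolding bases by (intro one_exchange_decompose[OF fin X]) auto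
next
  fix f :: "'a \<Rightarrow> nat"
  assume f0: "\<And>i. i \<notin> ground M \<Longrightarrow> f i = 0"
    and le: "\<And>S c. \<lbrakk>finite S; \<And>B. B \<in> bases M \<Longrightarrow> card (B \<inter> S) \<le> c\<rbrakk> \<Longrightarrow> sum f S \<le> c * t"
    and ge: "\<And>S c. \<lbrakk>finite S; \<And>B. B \<in> bases M \<Longrightarrow> c \<le> card (B \<inter> S)\<rbrakk> \<Longrightarrow> c * t \<le> sum f S"
  have finX: "finite X" using X fin finite_subset by blast
  have B: "card (B \<inter> E) = k \<and> k - 1 \<le> card (B \<inter> X)" if mem: "B \<in> bases M" for B
  proof (cases "B = X")
    case True
    then show ?thesis using X by (simp add: inf_absorb1)
  next
    case False
    then obtain a b where ab: "a \<in> X" "b \<in> E - X" "B = insert b (X - {a})"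
      using mem unfolding bases by blast
    then have "B \<inter> E = B" "B \<inter> X = X - {a}" using X(1) by auto
    moreover have "card B = k"
      using ab finX X(2) card_Suc_Diff1[OF finX ab(1)] by simp
    ultimately show ?thesis using X(2) by (simp add: card_Diff_singleton_if)
  qed
  have "sum f E = k * t"
    using le[of E k] ge[of E k] fin B by (intro antisym) auto
  moreover have "f i \<le> t" for i
    using le[of "{i}" 1] by (simp add: card_insert_if Int_insert_right)
  moreover have "(k - 1) * t \<le> sum f X"
    using B finX by (intro ge) auto
  then have "k * t \<le> sum f X + t" by (cases k) auto
  then have "k * t < sum f X + Suc t" by simp
  ultimately show "f \<in> {f \<in> box_points E t (int (k * t)). k * t < sum f X + Suc t}"
    using f0 ground by (simp only: mem_Collect_eq box_points_iff) blast
qed (use fin ground X in \<open>auto simp: bases\<close>)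

text \<open>Distinct members \<open>X\<close>, \<open>Y\<close> of \<open>N\<close> share at most
  \<open>k - 2\<close> elements. A point violating both inequalities would have sums over
  \<open>X\<close> and \<open>Y\<close> adding up to more than \<open>2 * (k - 1) * t\<close>,
  whereas union and intersection allow at most \<open>k * t + (k - 2) * t\<close>. So the violating
  sets are disjoint.\<close>

lemma card_box_points_nonadjacent:
  assumes fin: "finite E"
    and N: "\<And>X. X \<in> N \<Longrightarrow> X \<subseteq> E \<and> card X = k"
    and nonadjacent: "\<And>X a b. \<lbrakk>X \<in> N; a \<in> X; b \<in> E - X\<rbrakk> \<Longrightarrow> insert b (X - {a}) \<notin> N"
  shows "card (box_points E t (int (k * t)))
    = card {f \<in> box_points E t (int (k * t)). \<forall>X\<in>N. sum f X + t \<le> k * t}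
      + (\<Sum>X\<in>N. card {f \<in> box_points E t (int (k * t)). k * t < sum f X + t})"
    (is "card ?P = card ?good + (\<Sum>X\<in>N. card (?viol X))")
proof -
  have finP: "finite ?P" using fin by (rule finite_box_points)
  have "finite N" using N fin by (intro finite_subset[of N "Pow E"]) auto
  have disjoint: "?viol X \<inter> ?viol Y = {}" if XY: "X \<in> N" "Y \<in> N" "X \<noteq> Y" for X Y
  proof -
    have X: "X \<subseteq> E" "card X = k" "finite X" and Y: "Y \<subseteq> E" "card Y = k" "finite Y"
      using N[OF XY(1)] N[OF XY(2)] finite_subset[OF _ fin] by simp_all
    have less: "card (X \<inter> Y) < k"
    proof -
      have "X \<inter> Y \<noteq> X" using XY(3) X Y card_subset_eq[of Y X] by auto
      then show ?thesis using psubset_card_mono[OF X(3), of "X \<inter> Y"] X(2) by blast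
    qed
    have "card (X \<inter> Y) + 1 \<noteq> k"
    proof
      assume "card (X \<inter> Y) + 1 = k"
      then have "card (X - Y) = 1" "card (Y - X) = 1"
        using X Y by (simp_all add: card_Diff_subset_Int Int_commute)
      then obtain a b where ab: "X - Y = {a}" "Y - X = {b}" by (meson card_1_singletonE)
      then have "a \<in> X" "b \<in> E - X" "insert b (X - {a}) = Y" using Y(1) by auto
      then show False using nonadjacent[OF XY(1)] XY(2) by blast
    qed
    with less have card_Int: "card (X \<inter> Y) + 2 \<le> k" by simp
    have False if f: "f \<in> ?viol X" "f \<in> ?viol Y" for f
    proof -
      have f': "\<And>i. f i \<le> t" "sum f E = k * t" "k * t < sum f X + t" "k * t < sum f Y + t"
        using f by (auto simp: box_points_iff simp del: of_nat_mult)
      have "sum f X + sum f Y = sum f (X \<union> Y) + sum f (X \<inter> Y)"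
        using X Y by (simp add: sum.union_inter)
      moreover have "sum f (X \<union> Y) \<le> k * t"
        unfolding f'(2)[symmetric] using X Y fin by (intro sum_mono2) auto
      moreover have "sum f (X \<inter> Y) \<le> card (X \<inter> Y) * t"
        using sum_bounded_above[of "X \<inter> Y" f t] f'(1) by simp
      moreover have "(card (X \<inter> Y) + 2) * t \<le> k * t" using card_Int by (rule mult_le_mono1)
      ultimately show False using f'(3,4) by (simp add: algebra_simps)
    qed
    then show ?thesis by blast
  qed
  have "?P = ?good \<union> (\<Union>X\<in>N. ?viol X)" by (auto simp: not_le)
  moreover have "?good \<inter> (\<Union>X\<in>N. ?viol X) = {}" by fastforce
  ultimately have "card ?P = card ?good + card (\<Union>X\<in>N. ?viol X)"
    using finP \<open>finite N\<close> by (metis (no_types, lifting) card_Un_disjoint finite_Un)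
  also have "card (\<Union>X\<in>N. ?viol X) = (\<Sum>X\<in>N. card (?viol X))"
    using finP \<open>finite N\<close> disjoint by (intro card_UN_disjoint) auto
  finally show ?thesis .
qed

subsection \<open>The minimal matroid\<close>

text \<open>A cycle through a non-loop has length at least 2, so the cyclic predecessor or successor
  of \<open>e\<close> shares the vertex \<open>v\<close>. This local fact replaces an enumeration of
  cycles.\<close>

lemma cycle_second_edge:
  assumes "is_cycle G C" "e \<in> C" "v \<in> ends G e" "ends G e \<noteq> {v}"
  shows "\<exists>e'\<in>C. e' \<noteq> e \<and> v \<in> ends G e'"
proof -
  obtain vs es where es: "length vs = length es" "distinct es" "C = set es"
    and ends: "\<And>i. i < length es \<Longrightarrow> ends G (es ! i) = {vs ! i, vs ! (Suc i mod length es)}"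
    using assms(1) unfolding is_cycle_def by blast
  let ?l = "length es"
  obtain i where i: "i < ?l" "e = es ! i" using assms(2) es(3) by (metis in_set_conv_nth)
  have l: "1 < ?l"
  proof (rule ccontr)
    assume "\<not> ?thesis"
    then have "?l = 1" using i by linarith
    then show False using ends[OF i(1)] assms(3,4) i by auto
  qed
  have other: "\<exists>e'\<in>C. e' \<noteq> e \<and> v \<in> ends G e'" if "j < ?l" "j \<noteq> i" "v \<in> ends G (es ! j)" for j
    using that i es by (intro bexI[of _ "es ! j"]) (auto simp: nth_eq_iff_index_eq)
  from assms(3) consider "v = vs ! i" | "v = vs ! (Suc i mod ?l)"
    unfolding i(2) ends[OF i(1)] by blast
  then show ?thesis
  proof cases
    case 1
    show ?thesis
    proof (cases i)
      case 0
      have "0 < ?l" using l by linarith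
      then have "Suc (?l - 1) mod ?l = 0" by simp
      then show ?thesis
        using 0 1 l ends[of "?l - 1"] by (intro other[of "?l - 1"]) simp_all
    next
      case (Suc j)
      then show ?thesis
        using 1 i(1) ends[of j] by (intro other[of j]) auto
    qed
  next
    case 2
    have "Suc i mod ?l \<noteq> i" using i(1) l by (cases "Suc i = ?l") auto
    moreover have "Suc i mod ?l < ?l" using l by (intro mod_less_divisor) linarith
    ultimately show ?thesis using 2 ends by (intro other[of "Suc i mod ?l"]) auto
  qed
qed

lemma minimal_graph_sel [simp]:
  "verts (minimal_graph k n) = {0..k}" "edges (minimal_graph k n) = {1..n}"
  "ends (minimal_graph k n) i = (if i \<le> k then {i - 1, i} else {k, 0})"
  by (simp_all add: minimal_graph_def)

text \<open>Follow the cycle upwards: at vertex \<open>i < k\<close> the only continuation of path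
  edge \<open>i\<close> is edge \<open>Suc i\<close>, and at vertex \<open>k\<close> it is a closing
  edge. At vertex 0 a closing edge meets a second closing edge or edge 1, and the latter pulls in
  the whole path.\<close>

lemma minimal_graph_cycle:
  assumes "0 < k" "is_cycle (minimal_graph k n) C"
  shows "\<exists>j\<in>C. k < j \<and> ({1..k} \<subseteq> C \<or> (\<exists>j'\<in>C. j' \<noteq> j \<and> k < j'))"
proof -
  let ?G = "minimal_graph k n"
  have C: "C \<subseteq> {1..n}" "C \<noteq> {}"
    using assms(2) unfolding is_cycle_def by auto
  have next_edge: "Suc i \<in> C" if i: "i \<in> C" "i < k" for i
  proof -
    have "1 \<le> i" using i C by auto
    then have "i - 1 \<noteq> i" by simp
    then obtain e where e: "e \<in> C" "e \<noteq> i" "i \<in> ends ?G e"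
      using cycle_second_edge[OF assms(2) i(1), of i] i(2) by (auto simp del: diff_is_0_eq)
    then have "e = Suc i"
      using i \<open>1 \<le> i\<close> by (auto split: if_splits)
    then show ?thesis using e by simp
  qed
  have up: "m \<in> C" if "i \<in> C" "i \<le> m" "m \<le> k" for i m
    using that(2,3)
  proof (induction rule: dec_induct)
    case base
    show ?case by fact
  next
    case (step m)
    then show ?case using next_edge by simp
  qed
  obtain j where j: "j \<in> C" "k < j"
  proof -
    obtain i where i: "i \<in> C" using C by blast
    show thesis
    proof (cases "i \<le> k")
      case True
      then have "k \<in> C" using up[OF i] by simp
      moreover have "k - 1 \<noteq> k" using assms(1) by simp
      ultimately obtain e where e: "e \<in> C" "e \<noteq> k" "k \<in> ends ?G e"
        using cycle_second_edge[OF assms(2), of k k] by (auto simp del: diff_is_0_eq)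
      then have "k < e" using C by (auto split: if_splits)
      then show thesis using e that by blast
    qed (use i that in auto)
  qed
  obtain e where e: "e \<in> C" "e \<noteq> j" "0 \<in> ends ?G e"
    using cycle_second_edge[OF assms(2) j(1), of 0] j assms(1) by auto
  show ?thesis
  proof (cases "e \<le> k")
    case True
    then have "e = 1" using e C by (auto split: if_splits)
    then have "{1..k} \<subseteq> C" using up[OF e(1)] by auto
    then show ?thesis using j by blast
  next
    case False
    then have "k < e" by simp
    then show ?thesis using j e by blast
  qed
qed

lemma minimal_graph_parallel:
  assumes "i \<in> {k<..n}" "j \<in> {k<..n}" "i \<noteq> j" "0 < k"
  shows "is_cycle (minimal_graph k n) {i, j}"
  unfolding is_cycle_def
  using assms by (intro exI[of _ "[0, k]"] exI[of _ "[i, j]"]) (auto simp: less_Suc_eq)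

lemma minimal_graph_long_cycle:
  assumes "j \<in> {k<..n}"
  shows "is_cycle (minimal_graph k n) (insert j {1..k})"
proof -
  have "ends (minimal_graph k n) (([1..<Suc k] @ [j]) ! i)
      = {[0..<Suc k] ! i, [0..<Suc k] ! (Suc i mod Suc k)}" if "i < Suc k" for i
  proof (cases "i = k")
    case True
    then show ?thesis using assms by (simp add: nth_append del: upt_Suc)
  next
    case False
    then show ?thesis using that by (simp add: nth_append nth_upt del: upt_Suc)
  qed
  then show ?thesis
    unfolding is_cycle_def using assms
    by (intro exI[of _ "[0..<Suc k]"] exI[of _ "[1..<Suc k] @ [j]"]) (auto simp del: upt_Suc)
qed

text \<open>Every cycle contains two closing edges, or the path and a closing edge; both
  configurations are themselves cycles, so they decide acyclicity.\<close>

lemma forest_minimal_graph_iff: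
  assumes "0 < k"
  shows "forest (minimal_graph k n) F \<longleftrightarrow> F \<subseteq> {1..n} \<and>
    (\<forall>j\<in>F. k < j \<longrightarrow> \<not> {1..k} \<subseteq> F \<and> (\<forall>j'\<in>F. k < j' \<longrightarrow> j' = j))"
    (is "_ \<longleftrightarrow> ?R")
proof
  assume F: "forest (minimal_graph k n) F"
  then have sub: "F \<subseteq> {1..n}" and acyclic: "\<And>C. is_cycle (minimal_graph k n) C \<Longrightarrow> \<not> C \<subseteq> F"
    by (auto simp: forest_def)
  have "\<not> {1..k} \<subseteq> F" if "j \<in> F" "k < j" for j
    using acyclic[OF minimal_graph_long_cycle[of j k n]] that sub by auto
  moreover have "j' = j" if "j \<in> F" "k < j" "j' \<in> F" "k < j'" for j j'
  proof (rule ccontr)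
    assume "j' \<noteq> j"
    moreover have "j \<in> {k<..n}" "j' \<in> {k<..n}" using that sub by auto
    ultimately show False
      using acyclic[OF minimal_graph_parallel[of j' k n j]] that assms by auto
  qed
  ultimately show ?R using sub by blast
next
  assume R: ?R
  have "\<not> C \<subseteq> F" if C: "is_cycle (minimal_graph k n) C" for C
  proof
    assume "C \<subseteq> F"
    moreover obtain j where "j \<in> C" "k < j" "{1..k} \<subseteq> C \<or> (\<exists>j'\<in>C. j' \<noteq> j \<and> k < j')"
      using minimal_graph_cycle[OF assms C] by blast
    ultimately show False using R by blast
  qed
  then show "forest (minimal_graph k n) F"
    using R by (simp add: forest_def)
qed

lemma ground_minimal_matroid: "ground (minimal_matroid k n) = {1..n}"
  by (simp add: minimal_matroid_def graphic_matroid_def)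

text \<open>Every forest extends to one of the listed sets. These are forests of equal size
  \<open>k\<close>, so none contains another and they are exactly the maximal ones.\<close>

lemma bases_minimal_matroid:
  assumes "0 < k" "k \<le> n"
  shows "bases (minimal_matroid k n)
    = insert {1..k} {insert j ({1..k} - {i}) | i j. i \<in> {1..k} \<and> j \<in> {k<..n}}" (is "_ = ?B")
proof -
  let ?forest = "forest (minimal_graph k n)"
  have forests: "?forest B" if "B \<in> ?B" for B
    using that assms unfolding forest_minimal_graph_iff[OF assms(1)] by fastforce
  have extend: "\<exists>B\<in>?B. F \<subseteq> B" if "?forest F" for F
  proof (cases "F \<subseteq> {1..k}")
    case False
    have F: "F \<subseteq> {1..n}" "\<And>j. j \<in> F \<Longrightarrow> k < j \<Longrightarrow> \<not> {1..k} \<subseteq> F"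
      "\<And>j j'. j \<in> F \<Longrightarrow> k < j \<Longrightarrow> j' \<in> F \<Longrightarrow> k < j' \<Longrightarrow> j' = j"
      using that unfolding forest_minimal_graph_iff[OF assms(1)] by blast+
    obtain j where j: "j \<in> F" "j \<in> {k<..n}"
      using False F(1) by fastforce
    then have "\<not> {1..k} \<subseteq> F" using F(2)[of j] by simp
    then obtain i where i: "i \<in> {1..k}" "i \<notin> F" by blast
    have "F \<subseteq> insert j ({1..k} - {i})"
    proof
      fix x assume "x \<in> F"
      then show "x \<in> insert j ({1..k} - {i})"
        using F(1) F(3)[of j x] i j by (cases "k < x") auto
    qed
    moreover have "insert j ({1..k} - {i}) \<in> ?B" using i j by auto
    ultimately show ?thesis by blast
  qed blast
  have card: "finite B \<and> card B = k" if "B \<in> ?B" for B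
    using that by auto
  show ?thesis
  proof (intro equalityI subsetI)
    fix F assume "F \<in> bases (minimal_matroid k n)"
    then have F: "?forest F" "\<And>F'. ?forest F' \<Longrightarrow> F \<subseteq> F' \<Longrightarrow> F' = F"
      by (auto simp: minimal_matroid_def graphic_matroid_def)
    obtain B where B: "B \<in> ?B" "F \<subseteq> B" using extend[OF F(1)] by blast
    then have "B = F" using F(2)[OF forests[OF B(1)]] by blast
    then show "F \<in> ?B" using B(1) by blast
  next
    fix F assume F: "F \<in> ?B"
    have "F' = F" if F': "?forest F'" "F \<subseteq> F'" for F'
    proof -
      obtain B where B: "B \<in> ?B" "F' \<subseteq> B" using extend[OF F'(1)] by blast
      then have "F = B" using card[OF F] card[OF B(1)] F'(2) by (intro card_subset_eq) auto
      then show ?thesis using B F' by blast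
    qed
    then show "F \<in> bases (minimal_matroid k n)"
      using forests[OF F] by (simp add: minimal_matroid_def graphic_matroid_def)
  qed
qed

text \<open>The path edges form the fixed basis of the one-exchange description, and the slices run
  over \<open>s = 0, ..., t\<close>.\<close>

lemma lattice_count_minimal:
  "real (lattice_count (minimal_matroid (Suc a) (Suc a + Suc b)) t)
    = (\<Sum>s<Suc t. poly (binom_poly a * binom_poly b) (real s))"
proof -
  let ?k = "Suc a" and ?n = "Suc a + Suc b"
  have diff: "{1..?n} - {1..?k} = {?k<..?n}" by auto
  have "bases (minimal_matroid ?k ?n)
      = insert {1..?k} {insert j ({1..?k} - {i}) | i j. i \<in> {1..?k} \<and> j \<in> {1..?n} - {1..?k}}"
    unfolding diff by (rule bases_minimal_matroid) simp_all
  then have "lattice_count (minimal_matroid ?k ?n) t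
      = card {f \<in> box_points {1..?n} t (int (?k * t)). ?k * t < sum f {1..?k} + Suc t}"
    by (intro lattice_count_one_exchange ground_minimal_matroid) simp_all
  then show ?thesis
    using real_card_slices[of "{1..?n}" "{1..?k}" a b "Suc t" t] by simp
qed

subsection \<open>The Ehrhart polynomial of a sparse paving matroid\<close>

lemma lattice_count_uniform:
  assumes "k \<le> n"
  shows "lattice_count (uniform_matroid k n) t = card (box_points {1..n} t (int (k * t)))"
proof -
  have "{1..k} \<in> bases (uniform_matroid k n)" using assms by (simp add: uniform_matroid_def)
  then have "bases (uniform_matroid k n) \<noteq> {}" by blast
  then show ?thesis
    using lattice_count_nonadjacent[of "{1..n}" "uniform_matroid k n" k "{}" t]
    by (simp add: uniform_matroid_def)
qed

theorem corollary4p10: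
  fixes M :: "nat basis_system" and n k lam :: nat
  assumes "matroid M"
    and "ground M = {1..n}"
    and "matroid_rank M = k"
    and "sparse_paving M"
    and "card {X. circuit_hyperplane M X} = lam"
  shows "ehr M = ehr (uniform_matroid k n)
           - smult (real lam) (pcompose (ehr (minimal_matroid k n)) [:-1, 1:])"
proof -
  interpret sparse_paving_matroid M
    using assms by (simp add: sparse_paving_matroid_def sparse_paving_matroid_axioms_def)
  define N where "N = {X. X \<subseteq> {1..n} \<and> card X = k \<and> X \<notin> bases M}"
  have N: "X \<subseteq> {1..n} \<and> card X = k" if "X \<in> N" for X
    using that by (simp add: N_def)
  have nonbases: "nonbases = N" by (simp add: N_def assms)
  have lam: "card N = lam"
    using assms(5) by (simp add: circuit_hyperplane_iff nonbases[symmetric])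
  have kn: "k \<le> n" using rank_le_card_ground assms(2,3) by simp
  have nonadjacent: "insert b (X - {a}) \<notin> N" if "X \<in> N" "a \<in> X" "b \<in> {1..n} - X" for X a b
  proof -
    have "insert b (X - {a}) \<in> bases M"
      by (rule nonbases_neighbour) (use that assms(2,3) in \<open>simp_all add: N_def\<close>)
    then show ?thesis by (simp add: N_def)
  qed
  have bases: "bases M = {B. B \<subseteq> {1..n} \<and> card B = k \<and> B \<notin> N}"
    using bases_subset card_basis assms(2,3) by (auto simp: N_def)
  have N_pos: "0 < k" "k < n" if "X \<in> N" for X
    using nonbasis_between[of X] that assms(2,3) unfolding nonbases by simp_all
  then have N_pos': "N \<noteq> {} \<Longrightarrow> 0 < k" by blast
  let ?viol = "\<lambda>t X. {f \<in> box_points {1..n} t (int (k * t)). k * t < sum f X + t}"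
  have count: "card (box_points {1..n} t (int (k * t))) = lattice_count M t + (\<Sum>X\<in>N. card (?viol t X))" for t
    using card_box_points_nonadjacent[OF _ N nonadjacent, of t]
      lattice_count_nonadjacent[OF _ bases_nonempty assms(2) bases N N_pos' nonadjacent, of t]
    by simp
  obtain p where p: "\<And>t. poly p (real t) = real (card (box_points {1..n} t (int (k * t))))"
    using ex_poly_card_box_points[of "{1..n}" k] kn by auto
  have ehr_uniform: "ehr (uniform_matroid k n) = p"
    by (rule ehr_eqI) (simp only: p lattice_count_uniform[OF kn])
  show ?thesis
  proof (cases "N = {}")
    \<comment> \<open>Here \<open>k\<close> may be 0 or \<open>n\<close>; the subtracted term
      vanishes because \<open>lam = 0\<close>, whatever the polynomial of the minimal
      matroid.\<close>
    case True
    then have "ehr M = p" using count by (intro ehr_eqI) (simp only: p, simp)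
    then show ?thesis using True lam ehr_uniform by simp
  next
    case False
    then have "0 < k" "k < n" using N_pos by blast+
    then obtain a b where ab: "k = Suc a" "n = Suc a + Suc b"
      by (auto simp: gr0_conv_Suc dest!: less_imp_Suc_add)
    \<comment> \<open>At \<open>Suc t\<close> this sum counts the points for the minimal matroid, at
      \<open>t\<close> the points violating one inequality: hence the shift.\<close>
    obtain q where q: "\<And>t. poly q (real t - 1) = (\<Sum>s<t. poly (binom_poly a * binom_poly b) (real s))"
      using ex_sum_poly by blast
    have ehr_minimal: "ehr (minimal_matroid k n) = q"
    proof (rule ehr_eqI)
      show "poly q (real t) = real (lattice_count (minimal_matroid k n) t)" for t
        unfolding ab lattice_count_minimal using q[of "Suc t"] by (simp del: sum.lessThan_Suc)
    qed
    have viol: "real (card (?viol t X)) = poly q (real t - 1)" if "X \<in> N" for t X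
      unfolding q ab by (rule real_card_slices) (use N[OF that] ab in auto)
    show ?thesis
    proof (rule ehr_eqI)
      fix t
      have "real (card (box_points {1..n} t (int (k * t))))
          = real (lattice_count M t) + (\<Sum>X\<in>N. real (card (?viol t X)))"
        unfolding count by simp
      also have "(\<Sum>X\<in>N. real (card (?viol t X))) = (\<Sum>X\<in>N. poly q (real t - 1))"
        by (intro sum.cong refl viol)
      also have "\<dots> = real lam * poly q (real t - 1)"
        by (simp add: lam)
      finally show "poly (ehr (uniform_matroid k n)
          - smult (real lam) (pcompose (ehr (minimal_matroid k n)) [:-1, 1:])) (real t)
        = real (lattice_count M t)"
        by (simp add: ehr_uniform ehr_minimal p poly_pcompose)
    qed
  qed
qed

end
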